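(* Let $N\ge 2$, $a>-1$ and $\beta\in\{1,2,4\}$, corresponding respectively to correlation matrices with real, complex or quaternion entries. Let $\mathcal R_N^{(\beta)}$ be the set of $N\times N$ correlation matrices $R=[\rho_{jk}]$ over the corresponding field, with the measure $(\mathrm dR)$ equal to the product of Lebesgue measures over the $\beta$ real coordinates of each entry $\rho_{jk}$, $1\le k<j\le N$. Then $$C^{(\beta)}_{a,N}:=\int_{\mathcal R_N^{(\beta)}}(\det R)^a\,(\mathrm dR)=\prod_{k=1}^{N-1}\prod_{s=0}^{\beta-1}\left(B\left(a+\frac{\beta k+1-s}{2},\frac12\right)\right)^k=\prod_{k=1}^{N-1}\left(\frac{\pi^{\beta/2}\,\Gamma\left(a+\frac{\beta(k-1)}{2}+1\right)}{\Gamma\left(a+\frac{\beta k}{2}+1\right)}\right)^k$$ $$=\frac{\pi^{\beta N(N-1)/4}}{\left(\Gamma\left(a+\frac\beta2(N-1)+1\right)\right)^{N-1}}\prod_{k=1}^{N-1}\Gamma\left(a+\frac\beta2(k-1)+1\right).$$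
   Context: For $\beta=1$: a correlation matrix is a real symmetric positive definite matrix with unit diagonal. For $\beta=2$: a complex Hermitian positive definite matrix with unit diagonal; each entry has two real coordinates (real and imaginary parts). For $\beta=4$: a quaternion matrix, represented as a $2N\times 2N$ complex Hermitian positive definite matrix made of $2\times2$ blocks $\begin{bmatrix}z&w\\-\bar w&\bar z\end{bmatrix}$ with diagonal blocks equal to $I_2$; each off-diagonal block has the four real coordinates $\mathrm{Re}\,z,\mathrm{Im}\,z,\mathrm{Re}\,w,\mathrm{Im}\,w$, and $\det R$ is defined as the positive square root of the determinant of the $2N\times 2N$ complex matrix. $B(x,y)=\Gamma(x)\Gamma(y)/\Gamma(x+y)$. *)

theory Defs
  imports "HOL-Analysis.Analysis" "HOL-Combinatorics.Permutations"
begin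

text \<open>Coordinates of a correlation matrix: a real function on the index set of triples
  (j,k,s) with 0 <= k < j < N and s < beta; (j,k,s) is the s-th real coordinate of the entry
  rho_jk (0-based indices).\<close>
definition corr_index :: "nat \<Rightarrow> nat \<Rightarrow> (nat \<times> nat \<times> nat) set" where
  "corr_index \<beta> N = {(j,k,s). k < j \<and> j < N \<and> s < \<beta>}"

text \<open>Size of the associated complex matrix (2N x 2N for quaternions).\<close>
definition corr_size :: "nat \<Rightarrow> nat \<Rightarrow> nat" where
  "corr_size \<beta> N = (if \<beta> = 4 then 2 * N else N)"

definition low_entry :: "nat \<Rightarrow> (nat \<times> nat \<times> nat \<Rightarrow> real) \<Rightarrow> nat \<Rightarrow> nat \<Rightarrow> complex" where
  "low_entry \<beta> x j k = Complex (x (j,k,0)) (if \<beta> = 2 then x (j,k,1) else 0)"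

text \<open>Quaternion block for k < j: [[z, w], [-conj w, conj z]], z = x0 + i x1, w = x2 + i x3.\<close>
definition low_block :: "(nat \<times> nat \<times> nat \<Rightarrow> real) \<Rightarrow> nat \<Rightarrow> nat \<Rightarrow> nat \<Rightarrow> nat \<Rightarrow> complex" where
  "low_block x j k a b =
    (let z = Complex (x (j,k,0)) (x (j,k,1)); w = Complex (x (j,k,2)) (x (j,k,3)) in
     if a = 0 \<and> b = 0 then z else if a = 0 then w else if b = 0 then - cnj w else cnj z)"

definition corr_mat :: "nat \<Rightarrow> nat \<Rightarrow> (nat \<times> nat \<times> nat \<Rightarrow> real) \<Rightarrow> nat \<Rightarrow> nat \<Rightarrow> complex" where
  "corr_mat \<beta> N x p q =
    (if \<beta> = 4 then
       (let j = p div 2; a = p mod 2; k = q div 2; b = q mod 2 in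
        if j = k then (if a = b then 1 else 0)
        else if k < j then low_block x j k a b
        else cnj (low_block x k j b a))
     else
       (if p = q then 1
        else if q < p then low_entry \<beta> x p q
        else cnj (low_entry \<beta> x q p)))"

definition cdet :: "nat \<Rightarrow> (nat \<Rightarrow> nat \<Rightarrow> complex) \<Rightarrow> complex" where
  "cdet n M = (\<Sum>p | p permutes {..<n}. of_int (sign p) * (\<Prod>i<n. M i (p i)))"

definition hermitian_pd :: "nat \<Rightarrow> (nat \<Rightarrow> nat \<Rightarrow> complex) \<Rightarrow> bool" where
  "hermitian_pd n M \<longleftrightarrow>
     (\<forall>i<n. \<forall>j<n. M i j = cnj (M j i)) \<and>
     (\<forall>v :: nat \<Rightarrow> complex. (\<exists>i<n. v i \<noteq> 0) \<longrightarrow>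
        Re (\<Sum>i<n. \<Sum>j<n. cnj (v i) * M i j * v j) > 0)"

definition corr_set :: "nat \<Rightarrow> nat \<Rightarrow> (nat \<times> nat \<times> nat \<Rightarrow> real) set" where
  "corr_set \<beta> N = {x. hermitian_pd (corr_size \<beta> N) (corr_mat \<beta> N x)}"

text \<open>det R; for beta = 4 the positive square root of the 2N x 2N complex determinant.\<close>
definition corr_det :: "nat \<Rightarrow> nat \<Rightarrow> (nat \<times> nat \<times> nat \<Rightarrow> real) \<Rightarrow> real" where
  "corr_det \<beta> N x =
    (let d = Re (cdet (corr_size \<beta> N) (corr_mat \<beta> N x)) in if \<beta> = 4 then sqrt d else d)"

definition corr_measure :: "nat \<Rightarrow> nat \<Rightarrow> (nat \<times> nat \<times> nat \<Rightarrow> real) measure" where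
  "corr_measure \<beta> N = PiM (corr_index \<beta> N) (\<lambda>_. lborel)"

end

(* Every correlation matrix is R = L L^* with L lower triangular, where row j of L is
   (w_j, sqrt (1 - |w_j|^2)) with w_j in the open unit ball of R^(beta j) (for quaternions,
   2 x 2 blocks with a real scalar diagonal); conversely such an L gives a correlation matrix
   exactly when every w_j lies in the open ball. Read column by column, w |-> R is triangular:
   the real coordinates of the entry (j, k) are sqrt (1 - |w_k|^2) times those of w_jk plus terms
   in the columns before k. Hence the Jacobian is prod_k (1 - |w_k|^2)^(beta (N - 1 - k) / 2),
   while det R = prod_j (1 - |w_j|^2). The integral thus splits into ball integrals of
   (1 - |x|^2)^b, which integrating out one coordinate at a time (t = x^2) evaluates to
   prod_i B(b + 1 + i/2, 1/2); the Gamma forms follow from B(u, 1/2) = Gamma u sqrt pi / Gamma (u + 1/2)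
   by telescoping. *)

theory Submission
  imports Defs "Jordan_Normal_Form.Determinant"
begin

section \<open>Triangular changes of variables\<close>

lemma measurable_coordinate:
  "(\<lambda>w. w i) \<in> borel_measurable (PiM I (\<lambda>_. lborel :: real measure))"
proof (cases "i \<in> I")
  case True
  then show ?thesis by (simp add: measurable_component_singleton)
next
  case False
  have "\<forall>w\<in>space (PiM I (\<lambda>_. lborel :: real measure)). w i = undefined"
    using False by (auto simp: space_PiM PiE_def extensional_def)
  then show ?thesis by (subst measurable_cong[where g = "\<lambda>_. undefined"]) auto
qed

lemma nn_integral_fun_upd_affine:
  fixes g :: "('i \<Rightarrow> real) \<Rightarrow> ennreal"
  assumes g: "g \<in> borel_measurable (PiM (insert i I) (\<lambda>_. lborel))"
    and v: "v \<in> space (PiM I (\<lambda>_. lborel))" and i: "i \<notin> I" and c: "c > 0"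
  shows "(\<integral>\<^sup>+y. g (v(i := c * y + d)) * ennreal c \<partial>lborel) = (\<integral>\<^sup>+s. g (v(i := s)) \<partial>lborel)"
proof -
  have gv: "(\<lambda>s. g (v(i := s))) \<in> borel_measurable borel"
    using measurable_comp[OF measurable_component_update[OF v i] g] by (simp add: comp_def)
  have "(\<integral>\<^sup>+s. g (v(i := s)) \<partial>lborel) = ennreal c * (\<integral>\<^sup>+y. g (v(i := d + c * y)) \<partial>lborel)"
    using nn_integral_real_affine[OF gv, of c d] c by simp
  also have "\<dots> = (\<integral>\<^sup>+y. g (v(i := c * y + d)) * ennreal c \<partial>lborel)"
    using measurable_comp[OF _ gv, of "\<lambda>y. d + c * y"]
    by (subst nn_integral_cmult[symmetric]) (auto simp: comp_def mult.commute add.commute)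
  finally show ?thesis ..
qed

definition triangular_affine ::
    "'i set \<Rightarrow> ('i \<Rightarrow> ('i \<Rightarrow> real) \<Rightarrow> real) \<Rightarrow> ('i \<Rightarrow> ('i \<Rightarrow> real) \<Rightarrow> real) \<Rightarrow>
      ('i \<Rightarrow> real) \<Rightarrow> 'i \<Rightarrow> real" where
  "triangular_affine I c d w = (\<lambda>i\<in>I. c i w * w i + d i w)"

text \<open>With coordinates ordered by the rank \<open>r\<close>, these assumptions make \<open>triangular_affine I c d\<close>
  a triangular map with Jacobian \<open>\<Prod>i\<in>I. c i w\<close>.\<close>
locale triangular_coeffs =
  fixes I :: "'i set" and r :: "'i \<Rightarrow> nat" and c d :: "'i \<Rightarrow> ('i \<Rightarrow> real) \<Rightarrow> real"
  assumes finite_index: "finite I" and inj_rank: "inj_on r I"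
    and coeffs_depend_on_lower: "\<And>i w w'. i \<in> I \<Longrightarrow> (\<And>j. j \<in> I \<Longrightarrow> r j < r i \<Longrightarrow> w j = w' j) \<Longrightarrow>
      c i w = c i w' \<and> d i w = d i w'"
    and coeff_pos: "\<And>i w. i \<in> I \<Longrightarrow> c i w > 0"
    and measurable_coeff: "\<And>i J. i \<in> I \<Longrightarrow> c i \<in> borel_measurable (PiM J (\<lambda>_. lborel))"
    and measurable_shift: "\<And>i J. i \<in> I \<Longrightarrow> d i \<in> borel_measurable (PiM J (\<lambda>_. lborel))"
begin

lemma obtain_top:
  assumes "I \<noteq> {}"
  obtains i where "i \<in> I" "\<And>j. j \<in> I \<Longrightarrow> r j \<le> r i"
proof -
  have "Max (r ` I) \<in> r ` I" using assms finite_index by (intro Max_in) auto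
  then obtain i where "i \<in> I" "r i = Max (r ` I)" by auto
  with finite_index show ?thesis by (intro that) auto
qed

lemma remove_top:
  assumes "i \<in> I" and top: "\<And>j. j \<in> I \<Longrightarrow> r j \<le> r i"
  shows "triangular_coeffs (I - {i}) r c d"
proof
  fix j and w w' :: "'i \<Rightarrow> real" assume j: "j \<in> I - {i}" and agree: "\<And>k. k \<in> I - {i} \<Longrightarrow> r k < r j \<Longrightarrow> w k = w' k"
  have "r k < r j \<Longrightarrow> k \<noteq> i" for k using top[of j] j by auto
  then show "c j w = c j w' \<and> d j w = d j w'"
    using j agree by (intro coeffs_depend_on_lower) auto
qed (use finite_index inj_rank coeff_pos measurable_coeff measurable_shift in
     \<open>auto intro: inj_on_subset\<close>)

lemma coeffs_fun_upd_top:
  assumes "i \<in> I" and top: "\<And>j. j \<in> I \<Longrightarrow> r j \<le> r i" and j: "j \<in> I"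
  shows "c j (w(i := y)) = c j w" "d j (w(i := y)) = d j w"
proof -
  have "r k < r j \<Longrightarrow> (w(i := y)) k = w k" for k using top[OF j] by auto
  then show "c j (w(i := y)) = c j w" "d j (w(i := y)) = d j w"
    using coeffs_depend_on_lower[OF j, of "w(i := y)" w] by auto
qed

lemma triangular_affine_fun_upd_top:
  assumes i: "i \<in> I" and top: "\<And>j. j \<in> I \<Longrightarrow> r j \<le> r i"
  shows "triangular_affine I c d (w(i := y)) = (triangular_affine (I - {i}) c d w)(i := c i w * y + d i w)"
  using coeffs_fun_upd_top[OF i top] i by (auto simp: triangular_affine_def)

lemma measurable_triangular_affine:
  "triangular_affine I c d \<in> PiM I (\<lambda>_. lborel) \<rightarrow>\<^sub>M PiM I (\<lambda>_. lborel)"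
  unfolding triangular_affine_def
  using measurable_coeff measurable_shift measurable_coordinate by (intro measurable_restrict) auto

lemma nn_integral_slice_top:
  assumes i: "i \<in> I" and top: "\<And>j. j \<in> I \<Longrightarrow> r j \<le> r i"
    and g: "g \<in> borel_measurable (PiM I (\<lambda>_. lborel))" and x: "x \<in> space (PiM (I - {i}) (\<lambda>_. lborel))"
  shows "(\<integral>\<^sup>+y. g (triangular_affine I c d (x(i := y))) * ennreal (\<Prod>j\<in>I. c j (x(i := y))) \<partial>lborel)
         = (\<integral>\<^sup>+s. g ((triangular_affine (I - {i}) c d x)(i := s)) \<partial>lborel) * ennreal (\<Prod>j\<in>I - {i}. c j x)"
proof -
  interpret I': triangular_coeffs "I - {i}" r c d by (rule remove_top[OF i top])
  have g': "g \<in> borel_measurable (PiM (insert i (I - {i})) (\<lambda>_. lborel))" and i': "i \<notin> I - {i}"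
    using g i by (simp_all add: insert_absorb)
  have prod: "(\<Prod>j\<in>I. c j (x(i := y))) = c i x * (\<Prod>j\<in>I - {i}. c j x)" for y
    using coeffs_fun_upd_top[OF i top] by (simp add: prod.remove[OF finite_index i])
  have nonneg: "(\<Prod>j\<in>I - {i}. c j x) \<ge> 0" using I'.coeff_pos by (intro prod_nonneg) (auto intro: less_imp_le)
  have T'x: "triangular_affine (I - {i}) c d x \<in> space (PiM (I - {i}) (\<lambda>_. lborel))"
    using measurable_space[OF I'.measurable_triangular_affine x] .
  have "(\<lambda>y. g ((triangular_affine (I - {i}) c d x)(i := c i x * y + d i x))) \<in> borel_measurable borel"
    using measurable_comp[OF measurable_component_update[OF T'x i'] g'] by (simp add: comp_def)
  then have "(\<integral>\<^sup>+y. g (triangular_affine I c d (x(i := y))) * ennreal (\<Prod>j\<in>I. c j (x(i := y))) \<partial>lborel)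
      = (\<integral>\<^sup>+y. g ((triangular_affine (I - {i}) c d x)(i := c i x * y + d i x)) * ennreal (c i x) \<partial>lborel)
        * ennreal (\<Prod>j\<in>I - {i}. c j x)"
    using ennreal_mult[OF less_imp_le[OF coeff_pos[OF i]] nonneg]
    by (subst nn_integral_multc[symmetric])
       (auto simp: triangular_affine_fun_upd_top[OF i top] prod mult.assoc)
  also have "\<dots> = (\<integral>\<^sup>+s. g ((triangular_affine (I - {i}) c d x)(i := s)) \<partial>lborel) * ennreal (\<Prod>j\<in>I - {i}. c j x)"
    by (simp only: nn_integral_fun_upd_affine[OF g' T'x i' coeff_pos[OF i]])
  finally show ?thesis .
qed

end

lemma nn_integral_triangular_affine:
  assumes "triangular_coeffs I r c d" and "g \<in> borel_measurable (PiM I (\<lambda>_. lborel))"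
  shows "(\<integral>\<^sup>+w. g (triangular_affine I c d w) * ennreal (\<Prod>i\<in>I. c i w) \<partial>PiM I (\<lambda>_. lborel))
         = (\<integral>\<^sup>+w. g w \<partial>PiM I (\<lambda>_. lborel))"
  using triangular_coeffs.finite_index[OF assms(1)] assms
proof (induction I arbitrary: g rule: finite_psubset_induct)
  case (psubset I)
  interpret triangular_coeffs I r c d by (fact psubset.prems(1))
  interpret product_sigma_finite "\<lambda>_. lborel :: real measure" ..
  note g[measurable] = psubset.prems(2)
  show ?case
  proof (cases "I = {}")
    case True
    then show ?thesis by (intro nn_integral_cong) (auto simp: space_PiM triangular_affine_def)
  next
    case False
    then obtain i where i: "i \<in> I" and top: "\<And>j. j \<in> I \<Longrightarrow> r j \<le> r i" using obtain_top[OF False] by blast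
    define I' where "I' = I - {i}"
    have II': "I = insert i I'" and i': "i \<notin> I'" and fin': "finite I'"
      using i finite_index by (auto simp: I'_def)
    interpret I': triangular_coeffs I' r c d unfolding I'_def by (rule remove_top[OF i top])
    define H where "H v = (\<integral>\<^sup>+s. g (v(i := s)) \<partial>lborel)" for v
    have "(\<lambda>(v, s). g (v(i := s))) \<in> borel_measurable (PiM I' (\<lambda>_. lborel) \<Otimes>\<^sub>M lborel)"
      using measurable_comp[OF measurable_add_dim[of i I' "\<lambda>_. lborel"] g[unfolded II']]
      by (simp add: comp_def case_prod_unfold)
    then have H[measurable]: "H \<in> borel_measurable (PiM I' (\<lambda>_. lborel))"
      unfolding H_def by measurable
    have inner: "(\<integral>\<^sup>+y. g (triangular_affine I c d (x(i := y))) * ennreal (\<Prod>j\<in>I. c j (x(i := y))) \<partial>lborel)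
        = H (triangular_affine I' c d x) * ennreal (\<Prod>j\<in>I'. c j x)"
      if "x \<in> space (PiM I' (\<lambda>_. lborel))" for x
      unfolding H_def I'_def by (rule nn_integral_slice_top[OF i top g that[unfolded I'_def]])
    have "(\<integral>\<^sup>+w. g (triangular_affine I c d w) * ennreal (\<Prod>j\<in>I. c j w) \<partial>PiM I (\<lambda>_. lborel))
        = (\<integral>\<^sup>+x. H (triangular_affine I' c d x) * ennreal (\<Prod>j\<in>I'. c j x) \<partial>PiM I' (\<lambda>_. lborel))"
      unfolding II' using measurable_triangular_affine measurable_coeff
      by (subst product_nn_integral_insert[OF fin' i'])
         (auto simp: II'[symmetric] inner intro!: nn_integral_cong)
    also have "\<dots> = (\<integral>\<^sup>+v. H v \<partial>PiM I' (\<lambda>_. lborel))"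
      using psubset.IH[of I' H] I'.triangular_coeffs_axioms i H by (auto simp: I'_def)
    also have "\<dots> = (\<integral>\<^sup>+w. g w \<partial>PiM I (\<lambda>_. lborel))"
      unfolding H_def II' by (rule product_nn_integral_insert[OF fin' i', symmetric]) (use g II' in simp)
    finally show ?thesis .
  qed
qed

lemma triangular_affine_right_inverse:
  assumes "triangular_coeffs I r c d"
  shows "\<exists>S \<in> PiM I (\<lambda>_. lborel) \<rightarrow>\<^sub>M PiM I (\<lambda>_. lborel).
           \<forall>\<rho>\<in>space (PiM I (\<lambda>_. lborel)). triangular_affine I c d (S \<rho>) = \<rho>"
  using triangular_coeffs.finite_index[OF assms] assms
proof (induction I rule: finite_psubset_induct)
  case (psubset I)
  interpret triangular_coeffs I r c d by (fact psubset.prems)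
  show ?case
  proof (cases "I = {}")
    case True
    then show ?thesis
      by (intro bexI[of _ "\<lambda>\<rho>. \<rho>"]) (auto simp: space_PiM triangular_affine_def)
  next
    case False
    then obtain i where i: "i \<in> I" and top: "\<And>j. j \<in> I \<Longrightarrow> r j \<le> r i"
      using obtain_top[OF False] by blast
    define I' where "I' = I - {i}"
    interpret I': triangular_coeffs I' r c d unfolding I'_def by (rule remove_top[OF i top])
    obtain S' where S': "S' \<in> PiM I' (\<lambda>_. lborel) \<rightarrow>\<^sub>M PiM I' (\<lambda>_. lborel)"
      and S'_inv: "\<And>\<rho>. \<rho> \<in> space (PiM I' (\<lambda>_. lborel)) \<Longrightarrow> triangular_affine I' c d (S' \<rho>) = \<rho>"
      using psubset.IH[of I'] I'.triangular_coeffs_axioms i by (auto simp: I'_def)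
    define \<sigma> where "\<sigma> \<rho> = S' (restrict \<rho> I')" for \<rho> :: "'a \<Rightarrow> real"
    define S where "S \<rho> = (\<sigma> \<rho>)(i := (\<rho> i - d i (\<sigma> \<rho>)) / c i (\<sigma> \<rho>))" for \<rho>
    have \<sigma>[measurable]: "\<sigma> \<in> PiM I (\<lambda>_. lborel) \<rightarrow>\<^sub>M PiM I' (\<lambda>_. lborel)"
      unfolding \<sigma>_def using measurable_comp[OF measurable_restrict_subset S'] by (auto simp: I'_def comp_def)
    have [measurable]: "c i \<in> borel_measurable (PiM I' (\<lambda>_. lborel))" "d i \<in> borel_measurable (PiM I' (\<lambda>_. lborel))"
      using measurable_coeff[OF i] measurable_shift[OF i] by auto
    note measurable_coordinate[measurable]
    have "S \<in> PiM I (\<lambda>_. lborel) \<rightarrow>\<^sub>M PiM I (\<lambda>_. lborel)"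
      unfolding S_def by (rule measurable_fun_upd[where J = I']) (use i \<sigma> in \<open>auto simp: I'_def\<close>)
    moreover have "triangular_affine I c d (S \<rho>) = \<rho>" if \<rho>: "\<rho> \<in> space (PiM I (\<lambda>_. lborel))" for \<rho>
    proof -
      have "triangular_affine I' c d (\<sigma> \<rho>) = restrict \<rho> I'"
        unfolding \<sigma>_def by (rule S'_inv) (simp add: space_PiM)
      then show ?thesis
        using \<rho> i coeff_pos[OF i, of "\<sigma> \<rho>"]
        by (auto simp: S_def triangular_affine_fun_upd_top[OF i top] I'_def space_PiM PiE_def
                 extensional_def fun_eq_iff)
    qed
    ultimately show ?thesis by blast
  qed
qed

lemma borel_measurable_triangular_affine_cancel:
  assumes "triangular_coeffs I r c d"
    and "(\<lambda>w. g (triangular_affine I c d w)) \<in> borel_measurable (PiM I (\<lambda>_. lborel))"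
  shows "g \<in> borel_measurable (PiM I (\<lambda>_. lborel))"
proof -
  obtain S where S: "S \<in> PiM I (\<lambda>_. lborel) \<rightarrow>\<^sub>M PiM I (\<lambda>_. lborel)"
    and S_inv: "\<And>\<rho>. \<rho> \<in> space (PiM I (\<lambda>_. lborel)) \<Longrightarrow> triangular_affine I c d (S \<rho>) = \<rho>"
    using triangular_affine_right_inverse[OF assms(1)] by blast
  have "(\<lambda>\<rho>. g (triangular_affine I c d (S \<rho>))) \<in> borel_measurable (PiM I (\<lambda>_. lborel))"
    using measurable_comp[OF S assms(2)] by (simp add: comp_def)
  then show ?thesis using S_inv by (simp cong: measurable_cong)
qed

section \<open>Integrals over unit balls\<close>

lemma Beta_real_pos: "a > 0 \<Longrightarrow> b > 0 \<Longrightarrow> Beta a b > (0 :: real)"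
  by (simp add: Beta_def Gamma_real_pos)

lemma nn_integral_one_minus_square_powr:
  fixes b :: real
  assumes b: "b > -1"
  shows "(\<integral>\<^sup>+x. indicator {-1<..<1} x * ennreal ((1 - x\<^sup>2) powr b) \<partial>lborel) = ennreal (Beta (b+1) (1/2))"
proof -
  have "((\<lambda>t. t powr (-1 / 2) * (1 - t) powr b) has_integral
          Beta (1 / 2) (b + 1)) {0..1}"
    using has_integral_Beta_real[of "1/2" "b + 1"] b by simp
  from nn_integral_has_integral_lebesgue[OF _ this] have
     "ennreal (Beta (1 / 2) (b + 1)) =
        nn_integral lborel (\<lambda>t. ennreal (t powr (-1 / 2) * (1 - t) powr b *
                                indicator {0^2..1^2} t))"
    by (simp add: mult_ac ennreal_mult' ennreal_indicator)
  also have "\<dots> = (\<integral>\<^sup>+ x. ennreal (x\<^sup>2 powr - (1 / 2) * (1 - x\<^sup>2) powr b * (2 * x) *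
                          indicator {0..1} x) \<partial>lborel)"
    by (subst nn_integral_substitution[where g = "\<lambda>x. x ^ 2" and g' = "\<lambda>x. 2 * x"])
       (auto intro!: derivative_eq_intros continuous_intros simp: set_borel_measurable_def)
  also have "\<dots> = (\<integral>\<^sup>+ x. 2 * ennreal ((1 - x\<^sup>2) powr b * indicator {0..1} x) \<partial>lborel)"
    by (intro nn_integral_cong_AE AE_I[of _ _ "{0}"])
       (auto simp: indicator_def powr_minus powr_half_sqrt field_split_simps ennreal_mult')
  also have "\<dots> = (\<integral>\<^sup>+ x. ennreal ((1 - x\<^sup>2) powr b * indicator {0..1} x) \<partial>lborel) +
                    (\<integral>\<^sup>+ x. ennreal ((1 - x\<^sup>2) powr b * indicator {0..1} x) \<partial>lborel)"
    (is "_ = ?I + _") by (simp add: mult_2 nn_integral_add)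
  also have "?I = (\<integral>\<^sup>+ x. ennreal ((1 - x\<^sup>2) powr b * indicator {-1..0} x) \<partial>lborel)"
    by (subst nn_integral_real_affine[of _ "-1" 0])
       (auto simp: indicator_def intro!: nn_integral_cong)
  hence "?I + ?I = \<dots> + ?I" by simp
  also have "\<dots> = (\<integral>\<^sup>+ x. ennreal ((1 - x\<^sup>2) powr b *
                    (indicator {-1..0} x + indicator{0..1} x)) \<partial>lborel)"
    by (subst nn_integral_add [symmetric]) (auto simp: algebra_simps)
  also have "\<dots> = (\<integral>\<^sup>+ x. ennreal ((1 - x\<^sup>2) powr b * indicator {-1..1} x) \<partial>lborel)"
    by (intro nn_integral_cong_AE AE_I[of _ _ "{0}"]) (auto simp: indicator_def)
  also have "\<dots> = (\<integral>\<^sup>+x. indicator {-1<..<1} x * ennreal ((1 - x\<^sup>2) powr b) \<partial>lborel)"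
  proof (intro nn_integral_cong)
    fix x :: real
    have "x = -1 \<or> x = 1 \<Longrightarrow> (1 - x\<^sup>2) = 0" by auto
    thus "ennreal ((1 - x\<^sup>2) powr b * indicator {-1..1} x) = indicator {-1<..<1} x * ennreal ((1 - x\<^sup>2) powr b)"
      by (auto simp: indicator_def)
  qed
  finally show ?thesis by (simp add: Beta_commute)
qed

lemma nn_integral_radius_minus_square_powr:
  fixes b R :: real
  assumes b: "b > -1"
  shows "(\<integral>\<^sup>+t. (if t\<^sup>2 < R then ennreal ((R - t\<^sup>2) powr b) else 0) \<partial>lborel)
         = (if 0 < R then ennreal (R powr (b + 1/2) * Beta (b + 1) (1/2)) else 0)"
proof (cases "0 < R")
  case R: True
  have m: "(\<lambda>t. if t\<^sup>2 < R then ennreal ((R - t\<^sup>2) powr b) else 0) \<in> borel_measurable borel"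
    by measurable
  have scale: "(if (0 + sqrt R * x)\<^sup>2 < R then ennreal ((R - (0 + sqrt R * x)\<^sup>2) powr b) else 0)
      = ennreal (R powr b) * (indicator {-1<..<1} x * ennreal ((1 - x\<^sup>2) powr b))" for x
  proof -
    have "(sqrt R * x)\<^sup>2 = R * x\<^sup>2" "R - R * x\<^sup>2 = R * (1 - x\<^sup>2)"
      using R by (simp_all add: power_mult_distrib algebra_simps)
    moreover have "R * x\<^sup>2 < R \<longleftrightarrow> x \<in> {-1<..<1}"
      using R by (auto simp: abs_square_less_1 abs_less_iff)
    ultimately show ?thesis
      using R by (auto simp: indicator_def powr_mult ennreal_mult abs_square_less_1)
  qed
  have "(\<integral>\<^sup>+t. (if t\<^sup>2 < R then ennreal ((R - t\<^sup>2) powr b) else 0) \<partial>lborel)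
      = ennreal (sqrt R) * (\<integral>\<^sup>+x. ennreal (R powr b) * (indicator {-1<..<1} x * ennreal ((1 - x\<^sup>2) powr b)) \<partial>lborel)"
    using R by (simp only: nn_integral_real_affine[OF m, of "sqrt R" 0] scale real_sqrt_eq_zero_cancel_iff
        less_irrefl not_False_eq_True) simp
  also have "\<dots> = ennreal (sqrt R * R powr b * Beta (b + 1) (1/2))"
    using b R Beta_real_pos[of "b + 1" "1/2"]
    by (simp add: nn_integral_cmult nn_integral_one_minus_square_powr ennreal_mult'[symmetric])
  also have "sqrt R * R powr b = R powr (b + 1/2)"
    using R by (simp add: powr_add powr_half_sqrt mult.commute)
  finally show ?thesis using R by simp
next
  case False
  then have "\<not> t\<^sup>2 < R" for t :: real by (smt (verit) zero_le_power2)
  with False show ?thesis by simp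
qed

definition sq_norm :: "'i set \<Rightarrow> ('i \<Rightarrow> real) \<Rightarrow> real" where
  "sq_norm K x = (\<Sum>k\<in>K. (x k)\<^sup>2)"

definition ball_weight :: "'i set \<Rightarrow> real \<Rightarrow> ('i \<Rightarrow> real) \<Rightarrow> ennreal" where
  "ball_weight K b x = (if sq_norm K x < 1 then ennreal ((1 - sq_norm K x) powr b) else 0)"

lemma borel_measurable_sq_norm [measurable]:
  "sq_norm K \<in> borel_measurable (PiM J (\<lambda>_. lborel))"
  unfolding sq_norm_def by (intro borel_measurable_sum borel_measurable_power measurable_coordinate)

lemma borel_measurable_ball_weight [measurable]:
  "ball_weight K b \<in> borel_measurable (PiM J (\<lambda>_. lborel))"
  unfolding ball_weight_def by measurable

lemma sq_norm_cong: "(\<And>k. k \<in> K \<Longrightarrow> x k = y k) \<Longrightarrow> sq_norm K x = sq_norm K y"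
  by (simp add: sq_norm_def)

lemma ball_weight_cong: "(\<And>k. k \<in> K \<Longrightarrow> x k = y k) \<Longrightarrow> ball_weight K b x = ball_weight K b y"
  by (simp add: ball_weight_def sq_norm_cong[of K x y])

lemma nn_integral_ball_weight_fun_upd:
  assumes "finite K" and i: "i \<notin> K" and b: "b > -1"
  shows "(\<integral>\<^sup>+y. ball_weight (insert i K) b (x(i := y)) \<partial>lborel)
         = ball_weight K (b + 1/2) x * ennreal (Beta (b + 1) (1/2))"
proof -
  have "sq_norm (insert i K) (x(i := y)) = y\<^sup>2 + sq_norm K x" for y
  proof -
    have "sq_norm K (x(i := y)) = sq_norm K x" using i by (intro sq_norm_cong) auto
    then show ?thesis using assms by (simp add: sq_norm_def)
  qed
  then have "ball_weight (insert i K) b (x(i := y))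
      = (if y\<^sup>2 < 1 - sq_norm K x then ennreal ((1 - sq_norm K x - y\<^sup>2) powr b) else 0)" for y
    by (simp add: ball_weight_def algebra_simps)
  then show ?thesis
    using nn_integral_radius_minus_square_powr[OF b, of "1 - sq_norm K x"] Beta_real_pos[of "b + 1" "1/2"] b
    by (simp add: ball_weight_def ennreal_mult)
qed

lemma nn_integral_ball_weight:
  fixes K :: "'i set" and b :: real
  assumes "finite K" "b > -1"
  shows "(\<integral>\<^sup>+x. ball_weight K b x \<partial>PiM K (\<lambda>_. lborel))
         = ennreal (\<Prod>i<card K. Beta (b + 1 + real i / 2) (1/2))"
  using assms
proof (induction K arbitrary: b rule: finite_induct)
  case empty
  show ?case by (simp add: PiM_empty nn_integral_count_space_finite ball_weight_def sq_norm_def)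
next
  case (insert i K b)
  interpret product_sigma_finite "\<lambda>_. lborel :: real measure" ..
  have "(\<integral>\<^sup>+x. ball_weight (insert i K) b x \<partial>PiM (insert i K) (\<lambda>_. lborel))
      = (\<integral>\<^sup>+x. ball_weight K (b + 1/2) x * ennreal (Beta (b + 1) (1/2)) \<partial>PiM K (\<lambda>_. lborel))"
    using insert.hyps insert.prems by (simp add: product_nn_integral_insert nn_integral_ball_weight_fun_upd)
  also have "\<dots> = ennreal (\<Prod>j<card K. Beta (b + 1/2 + 1 + real j / 2) (1/2)) * ennreal (Beta (b + 1) (1/2))"
    using insert.IH[of "b + 1/2"] insert.prems by (simp add: nn_integral_multc)
  also have "\<dots> = ennreal (\<Prod>j<card (insert i K). Beta (b + 1 + real j / 2) (1/2))"
  proof -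
    have "(\<Prod>j<card (insert i K). Beta (b + 1 + real j / 2) (1/2))
        = Beta (b + 1) (1/2) * (\<Prod>j<card K. Beta (b + 1 + real (Suc j) / 2) (1/2))"
      by (simp only: card_insert_disjoint[OF insert.hyps] prod.lessThan_Suc_shift) simp
    also have "(\<Prod>j<card K. Beta (b + 1 + real (Suc j) / 2) (1/2))
        = (\<Prod>j<card K. Beta (b + 1/2 + 1 + real j / 2) (1/2))"
      by (intro prod.cong) (auto simp: field_simps)
    finally show ?thesis
      using Beta_real_pos insert.prems
      by (simp add: ennreal_mult'[symmetric] prod_nonneg less_imp_le mult.commute)
  qed
  finally show ?case .
qed

lemma nn_integral_prod_blocks:
  fixes K :: "nat \<Rightarrow> 'i set" and f :: "nat \<Rightarrow> ('i \<Rightarrow> real) \<Rightarrow> ennreal"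
  assumes "disjoint_family_on K {..<N}" and "\<And>j. finite (K j)"
    and f_meas: "\<And>j J. f j \<in> borel_measurable (PiM J (\<lambda>_. lborel))"
    and f_local: "\<And>j w w'. (\<And>i. i \<in> K j \<Longrightarrow> w i = w' i) \<Longrightarrow> f j w = f j w'"
  shows "(\<integral>\<^sup>+w. (\<Prod>j<N. f j w) \<partial>PiM (\<Union>j<N. K j) (\<lambda>_. lborel))
         = (\<Prod>j<N. \<integral>\<^sup>+w. f j w \<partial>PiM (K j) (\<lambda>_. lborel))"
  using assms(1)
proof (induction N)
  case 0
  then show ?case by (simp add: PiM_empty nn_integral_count_space_finite)
next
  case (Suc N)
  interpret product_sigma_finite "\<lambda>_. lborel :: real measure" ..
  let ?I = "\<Union>j<N. K j"
  have disj: "?I \<inter> K N = {}"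
  proof -
    have "K j \<inter> K N = {}" if "j < N" for j
      using that by (intro disjoint_family_onD[OF Suc.prems]) auto
    then show ?thesis by blast
  qed
  have "(\<integral>\<^sup>+w. (\<Prod>j<Suc N. f j w) \<partial>PiM (\<Union>j<Suc N. K j) (\<lambda>_. lborel))
      = (\<integral>\<^sup>+x. \<integral>\<^sup>+y. (\<Prod>j<Suc N. f j (merge ?I (K N) (x, y))) \<partial>PiM (K N) (\<lambda>_. lborel) \<partial>PiM ?I (\<lambda>_. lborel))"
    unfolding lessThan_Suc UN_insert Un_commute[of "K N"]
    by (rule product_nn_integral_fold[OF disj]) (use assms(2) f_meas in \<open>auto intro: borel_measurable_prod_ennreal\<close>)
  also have "\<dots> = (\<integral>\<^sup>+x. (\<Prod>j<N. f j x) * (\<integral>\<^sup>+y. f N y \<partial>PiM (K N) (\<lambda>_. lborel)) \<partial>PiM ?I (\<lambda>_. lborel))"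
  proof (intro nn_integral_cong)
    fix x
    have "f j (merge ?I (K N) (x, y)) = f j x" if "j < N" for j y
      using that by (intro f_local) (auto simp: merge_def)
    moreover have "f N (merge ?I (K N) (x, y)) = f N y" for y
      using disj by (intro f_local) (auto simp: merge_def)
    ultimately show "(\<integral>\<^sup>+y. (\<Prod>j<Suc N. f j (merge ?I (K N) (x, y))) \<partial>PiM (K N) (\<lambda>_. lborel))
        = (\<Prod>j<N. f j x) * (\<integral>\<^sup>+y. f N y \<partial>PiM (K N) (\<lambda>_. lborel))"
      using f_meas by (simp add: nn_integral_cmult)
  qed
  also have "\<dots> = (\<Prod>j<Suc N. \<integral>\<^sup>+w. f j w \<partial>PiM (K j) (\<lambda>_. lborel))"
  proof -
    have "disjoint_family_on K {..<N}"
      using Suc.prems by (rule disjoint_family_on_mono[rotated]) auto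
    then show ?thesis
      using Suc.IH f_meas by (simp add: nn_integral_multc borel_measurable_prod_ennreal)
  qed
  finally show ?case .
qed

section \<open>Products of Beta and Gamma values\<close>

lemma Beta_one_half_real: "Beta u (1/2) = Gamma u * sqrt pi / Gamma (u + 1/2)" for u :: real
  by (simp add: Beta_def Gamma_one_half_real)

lemma prod_Beta_one_half:
  fixes u :: real
  assumes u: "u > 0"
  shows "(\<Prod>i<m. Beta (u + real i / 2) (1/2)) = pi powr (real m / 2) * Gamma u / Gamma (u + real m / 2)"
proof (induction m)
  case 0
  show ?case using Gamma_real_pos[OF u] by simp
next
  case (Suc m)
  have "Gamma (u + real m / 2) > 0" using u by (intro Gamma_real_pos) (simp add: add_pos_nonneg)
  then have "(\<Prod>i<Suc m. Beta (u + real i / 2) (1/2))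
      = (pi powr (real m / 2) * sqrt pi) * Gamma u / Gamma (u + real m / 2 + 1/2)"
    by (simp only: prod.lessThan_Suc Suc.IH) (simp add: Beta_one_half_real)
  also have "pi powr (real m / 2) * sqrt pi = pi powr (real (Suc m) / 2)"
  proof -
    have "real (Suc m) / 2 = real m / 2 + 1/2" by simp
    then show ?thesis by (simp only: powr_add powr_half_sqrt[OF pi_ge_zero])
  qed
  also have "u + real m / 2 + 1/2 = u + real (Suc m) / 2" by (simp add: field_simps)
  finally show ?case .
qed

lemma prod_Beta_row:
  fixes a :: real and \<beta> k :: nat
  assumes a: "a > -1" and k: "k \<ge> 1"
  shows "(\<Prod>s<\<beta>. Beta (a + (real \<beta> * real k + 1 - real s) / 2) (1/2))
       = pi powr (real \<beta> / 2) * Gamma (a + real \<beta> * (real k - 1) / 2 + 1) / Gamma (a + real \<beta> * real k / 2 + 1)"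
proof -
  define u where "u = a + real \<beta> * (real k - 1) / 2 + 1"
  have "real \<beta> * (real k - 1) / 2 \<ge> 0" using k by simp
  with a have u: "u > 0" unfolding u_def by linarith
  have "(\<Prod>s<\<beta>. Beta (a + (real \<beta> * real k + 1 - real s) / 2) (1/2))
      = (\<Prod>s<\<beta>. Beta (u + real (\<beta> - Suc s) / 2) (1/2))"
    by (intro prod.cong refl arg_cong[where f = "\<lambda>x. Beta x (1/2)"])
       (auto simp: u_def of_nat_diff field_simps)
  also have "\<dots> = pi powr (real \<beta> / 2) * Gamma u / Gamma (u + real \<beta> / 2)"
    by (subst prod.nat_diff_reindex[where g = "\<lambda>t. Beta (u + real t / 2) (1/2)"])
       (rule prod_Beta_one_half[OF u])
  finally show ?thesis by (simp add: u_def field_simps)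
qed

lemma prod_quotient_power_telescope:
  fixes g :: "nat \<Rightarrow> 'a :: field"
  assumes "\<And>k. g k \<noteq> 0"
  shows "(\<Prod>k=1..M. (g (k - 1) / g k) ^ k) = (\<Prod>k<M. g k) / g M ^ M"
proof (induction M)
  case (Suc M)
  then show ?case using assms by (simp add: prod.nat_ivl_Suc' field_simps)
qed simp

lemma sum_atLeast1_atMost_real: "(\<Sum>k=1..M. real k) = real M * (real M + 1) / 2"
  by (induction M) (simp_all add: field_simps)

lemma prod_powr_power_atLeast1:
  fixes x c :: real
  assumes "x \<noteq> 0"
  shows "(\<Prod>k=1..M. (x powr c) ^ k) = x powr (real M * (real M + 1) / 2 * c)"
proof -
  have "(\<Prod>k=1..M. (x powr c) ^ k) = x powr (\<Sum>k=1..M. real k * c)"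
    using assms by (simp add: powr_power powr_sum)
  also have "(\<Sum>k=1..M. real k * c) = (\<Sum>k=1..M. real k) * c"
    by (rule sum_distrib_right[symmetric])
  also have "(\<Sum>k=1..M. real k) = real M * (real M + 1) / 2"
    by (rule sum_atLeast1_atMost_real)
  finally show ?thesis .
qed

lemma prod_Gamma_ratio_powers:
  fixes a :: real and \<beta> N :: nat
  assumes a: "a > -1" and N: "N \<ge> 1"
  shows "(\<Prod>k=1..N-1. (pi powr (real \<beta> / 2) * Gamma (a + real \<beta> * (real k - 1) / 2 + 1)
                          / Gamma (a + real \<beta> * real k / 2 + 1)) ^ k)
         = pi powr (real \<beta> * real N * (real N - 1) / 4)
           / (Gamma (a + real \<beta> / 2 * (real N - 1) + 1)) ^ (N - 1)
           * (\<Prod>k=1..N-1. Gamma (a + real \<beta> / 2 * (real k - 1) + 1))"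
proof -
  define g where "g k = Gamma (a + real \<beta> / 2 * real k + 1)" for k
  have g: "g k \<noteq> 0" for k
  proof -
    have "real \<beta> / 2 * real k \<ge> 0" by simp
    with a have "Gamma (a + real \<beta> / 2 * real k + 1) > 0" by (intro Gamma_real_pos) linarith
    then show ?thesis by (simp add: g_def)
  qed
  have factor: "pi powr (real \<beta> / 2) * Gamma (a + real \<beta> * (real k - 1) / 2 + 1)
      / Gamma (a + real \<beta> * real k / 2 + 1) = pi powr (real \<beta> / 2) * (g (k - 1) / g k)" if "k \<ge> 1" for k
    using that by (simp add: g_def of_nat_diff field_simps)
  have pi_part: "(\<Prod>k=1..N-1. (pi powr (real \<beta> / 2)) ^ k) = pi powr (real \<beta> * real N * (real N - 1) / 4)"
    using N prod_powr_power_atLeast1[of pi "real \<beta> / 2" "N - 1"] by (simp add: of_nat_diff field_simps)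
  have "(\<Prod>k=1..N-1. (pi powr (real \<beta> / 2) * Gamma (a + real \<beta> * (real k - 1) / 2 + 1)
                          / Gamma (a + real \<beta> * real k / 2 + 1)) ^ k)
      = (\<Prod>k=1..N-1. (pi powr (real \<beta> / 2)) ^ k * (g (k - 1) / g k) ^ k)"
  proof (intro prod.cong refl)
    fix k assume "k \<in> {1..N-1}"
    then have "k \<ge> 1" by simp
    from factor[OF this] show "(pi powr (real \<beta> / 2) * Gamma (a + real \<beta> * (real k - 1) / 2 + 1)
        / Gamma (a + real \<beta> * real k / 2 + 1)) ^ k = (pi powr (real \<beta> / 2)) ^ k * (g (k - 1) / g k) ^ k"
      by (simp only: power_mult_distrib)
  qed
  also have "\<dots> = (\<Prod>k=1..N-1. (pi powr (real \<beta> / 2)) ^ k) * ((\<Prod>k<N - 1. g k) / g (N - 1) ^ (N - 1))"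
    by (simp only: prod.distrib prod_quotient_power_telescope[of g "N - 1", OF g])
  also have "(\<Prod>k<N - 1. g k) = (\<Prod>k=1..N-1. Gamma (a + real \<beta> / 2 * (real k - 1) + 1))"
    by (simp add: prod.atLeast1_atMost_eq g_def)
  also have "g (N - 1) = Gamma (a + real \<beta> / 2 * (real N - 1) + 1)"
    using N by (simp add: g_def of_nat_diff)
  finally show ?thesis by (simp only: pi_part) simp
qed

lemma sum_lessThan_real: "(\<Sum>j<N. real j) = real N * (real N - 1) / 2"
  by (induction N) (simp_all add: field_simps)

lemma prod_Beta_ball_row:
  fixes a :: real and \<beta> N j :: nat
  assumes a: "a > -1" and j: "j < N"
  shows "(\<Prod>i<\<beta> * j. Beta (a + real \<beta> * real (N - 1 - j) / 2 + 1 + real i / 2) (1/2))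
       = pi powr (real \<beta> * real j / 2) * Gamma (a + real \<beta> / 2 * real (N - Suc j) + 1)
           / Gamma (a + real \<beta> / 2 * real (N - 1) + 1)"
proof -
  define u where "u = a + real \<beta> * real (N - 1 - j) / 2 + 1"
  have "real \<beta> * real (N - 1 - j) / 2 \<ge> 0" by simp
  with a have u: "u > 0" unfolding u_def by linarith
  have "(\<Prod>i<\<beta> * j. Beta (a + real \<beta> * real (N - 1 - j) / 2 + 1 + real i / 2) (1/2))
      = pi powr (real (\<beta> * j) / 2) * Gamma u / Gamma (u + real (\<beta> * j) / 2)"
    unfolding u_def by (rule prod_Beta_one_half[OF u[unfolded u_def]])
  also have "u + real (\<beta> * j) / 2 = a + real \<beta> / 2 * real (N - 1) + 1"
    using j by (simp add: u_def of_nat_diff field_simps)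
  finally show ?thesis by (simp add: u_def mult.commute)
qed

lemma prod_Beta_balls:
  fixes a :: real and \<beta> N :: nat
  assumes a: "a > -1" and N: "N \<ge> 1"
  shows "(\<Prod>j<N. \<Prod>i<\<beta> * j. Beta (a + real \<beta> * real (N - 1 - j) / 2 + 1 + real i / 2) (1/2))
       = pi powr (real \<beta> * real N * (real N - 1) / 4)
           / (Gamma (a + real \<beta> / 2 * (real N - 1) + 1)) ^ (N - 1)
           * (\<Prod>k=1..N-1. Gamma (a + real \<beta> / 2 * (real k - 1) + 1))"
proof -
  define g where "g k = Gamma (a + real \<beta> / 2 * real k + 1)" for k
  have g: "g k > 0" for k
  proof -
    have "real \<beta> / 2 * real k \<ge> 0" by simp
    with a show ?thesis unfolding g_def by (intro Gamma_real_pos) linarith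
  qed
  have "(\<Prod>j<N. \<Prod>i<\<beta> * j. Beta (a + real \<beta> * real (N - 1 - j) / 2 + 1 + real i / 2) (1/2))
      = (\<Prod>j<N. pi powr (real \<beta> * real j / 2) * g (N - Suc j) / g (N - 1))"
    unfolding g_def by (intro prod.cong refl prod_Beta_ball_row[OF a]) simp
  also have "\<dots> = (\<Prod>j<N. pi powr (real \<beta> * real j / 2)) * (\<Prod>j<N. g (N - Suc j)) / g (N - 1) ^ N"
    by (simp add: prod.distrib prod_dividef)
  also have "(\<Prod>j<N. pi powr (real \<beta> * real j / 2)) = pi powr (real \<beta> * real N * (real N - 1) / 4)"
    by (simp add: powr_sum[symmetric] sum_divide_distrib[symmetric] sum_distrib_left[symmetric]
        sum_lessThan_real mult.assoc)
  also have "(\<Prod>j<N. g (N - Suc j)) = (\<Prod>k<N - 1. g k) * g (N - 1)"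
    using N by (simp add: prod.nat_diff_reindex[where g = g] prod.lessThan_Suc[symmetric])
  also have "(\<Prod>k<N - 1. g k) = (\<Prod>k=1..N-1. Gamma (a + real \<beta> / 2 * (real k - 1) + 1))"
    by (simp add: prod.atLeast1_atMost_eq g_def)
  also have "g (N - 1) = Gamma (a + real \<beta> / 2 * (real N - 1) + 1)"
    using N by (simp add: g_def of_nat_diff)
  also have "x * (y * G) / G ^ N = x / G ^ (N - 1) * y" if "G \<noteq> 0" for x y G :: real
    using that N by (cases N) simp_all
  finally show ?thesis
    using g[of "N - 1"] N by (simp add: g_def of_nat_diff)
qed

section \<open>Gram matrices of triangular matrices\<close>

lemma (in comm_monoid_set) eq_single:
  assumes "finite A" "a \<in> A" "\<And>b. b \<in> A \<Longrightarrow> b \<noteq> a \<Longrightarrow> g b = \<^bold>1"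
  shows "F g A = g a"
  using assms by (simp add: remove[of A a] neutral)

lemma (in comm_monoid_set) lessThan_double:
  "F g {..<2 * (n :: nat)} = F (\<lambda>m. g (2 * m) \<^bold>* g (2 * m + 1)) {..<n}"
  by (induction n) (simp_all add: ac_simps)

lemma hermitian_pd_cong:
  assumes "\<And>i j. i < n \<Longrightarrow> j < n \<Longrightarrow> M i j = M' i j"
  shows "hermitian_pd n M = hermitian_pd n M'"
proof -
  have "(\<Sum>i<n. \<Sum>j<n. cnj (v i) * M i j * v j) = (\<Sum>i<n. \<Sum>j<n. cnj (v i) * M' i j * v j)" for v
    using assms by (intro sum.cong) auto
  then show ?thesis using assms by (auto simp: hermitian_pd_def)
qed

lemma cdet_cong:
  assumes "\<And>i j. i < n \<Longrightarrow> j < n \<Longrightarrow> M i j = M' i j"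
  shows "cdet n M = cdet n M'"
  unfolding cdet_def
proof (intro sum.cong refl)
  fix p assume "p \<in> {p. p permutes {..<n}}"
  hence p: "p permutes {..<n}" by simp
  show "of_int (sign p) * (\<Prod>i<n. M i (p i)) = of_int (sign p) * (\<Prod>i<n. M' i (p i))"
  proof -
    have "(\<Prod>i<n. M i (p i)) = (\<Prod>i<n. M' i (p i))"
      by (rule prod.cong) (use assms permutes_in_image[OF p] in auto)
    thus ?thesis by simp
  qed
qed

definition gram :: "nat \<Rightarrow> (nat \<Rightarrow> nat \<Rightarrow> complex) \<Rightarrow> nat \<Rightarrow> nat \<Rightarrow> complex" where
  "gram n L p q = (\<Sum>r<n. L p r * cnj (L q r))"

lemma gram_swap: "gram n L q p = cnj (gram n L p q)"
  by (simp add: gram_def mult.commute)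

lemma quadratic_form_gram:
  "(\<Sum>i<n. \<Sum>j<n. cnj (v i) * gram n L i j * v j)
     = (\<Sum>r<n. (\<Sum>i<n. cnj (v i) * L i r) * cnj (\<Sum>i<n. cnj (v i) * L i r))"
proof -
  have "(\<Sum>i<n. \<Sum>j<n. cnj (v i) * gram n L i j * v j)
      = (\<Sum>i<n. \<Sum>j<n. \<Sum>r<n. (cnj (v i) * L i r) * (cnj (L j r) * v j))"
    unfolding gram_def by (simp add: sum_distrib_left sum_distrib_right mult.assoc)
  also have "\<dots> = (\<Sum>r<n. \<Sum>i<n. \<Sum>j<n. (cnj (v i) * L i r) * (cnj (L j r) * v j))"
  proof -
    have "(\<Sum>i<n. \<Sum>j<n. \<Sum>r<n. (cnj (v i) * L i r) * (cnj (L j r) * v j))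
        = (\<Sum>i<n. \<Sum>r<n. \<Sum>j<n. (cnj (v i) * L i r) * (cnj (L j r) * v j))"
      by (rule sum.cong[OF refl], rule sum.swap)
    also have "\<dots> = (\<Sum>r<n. \<Sum>i<n. \<Sum>j<n. (cnj (v i) * L i r) * (cnj (L j r) * v j))"
      by (rule sum.swap)
    finally show ?thesis .
  qed
  also have "\<dots> = (\<Sum>r<n. (\<Sum>i<n. cnj (v i) * L i r) * (\<Sum>j<n. cnj (L j r) * v j))"
    by (simp add: sum_product)
  also have "\<dots> = (\<Sum>r<n. (\<Sum>i<n. cnj (v i) * L i r) * cnj (\<Sum>i<n. cnj (v i) * L i r))"
    by (simp add: mult.commute)
  finally show ?thesis .
qed

lemma hermitian_pd_gram:
  fixes L :: "nat \<Rightarrow> nat \<Rightarrow> complex"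
  assumes low: "\<And>i r. i < r \<Longrightarrow> L i r = 0" and diag: "\<And>r. r < n \<Longrightarrow> L r r \<noteq> 0"
  shows "hermitian_pd n (gram n L)"
  unfolding hermitian_pd_def
proof (intro conjI allI impI)
  fix i j show "gram n L i j = cnj (gram n L j i)" by (rule gram_swap)
next
  fix v :: "nat \<Rightarrow> complex" assume "\<exists>i<n. v i \<noteq> 0"
  then have ne: "{i. i < n \<and> v i \<noteq> 0} \<noteq> {}" by blast
  define q where "q = Max {i. i < n \<and> v i \<noteq> 0}"
  have fin: "finite {i. i < n \<and> v i \<noteq> 0}" by simp
  have q: "q < n" "v q \<noteq> 0" using Max_in[OF fin ne] by (auto simp: q_def)
  have above: "v i = 0" if "q < i" "i < n" for i
  proof (rule ccontr)
    assume "v i \<noteq> 0"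
    then have "i \<le> q" using Max_ge[OF fin, of i] that by (simp add: q_def)
    with that show False by simp
  qed
  define u where "u r = (\<Sum>i<n. cnj (v i) * L i r)" for r
  \<comment> \<open>the last nonzero entry of \<open>v\<close> survives in \<open>L\<^sup>* v\<close>\<close>
  have "u q = cnj (v q) * L q q"
    unfolding u_def using q above low by (intro sum.eq_single) (auto simp: neq_iff)
  then have "0 < (cmod (u q))\<^sup>2" using q diag by simp
  also have "\<dots> \<le> (\<Sum>r<n. (cmod (u r))\<^sup>2)"
    using q by (intro member_le_sum) auto
  also have "\<dots> = Re (\<Sum>i<n. \<Sum>j<n. cnj (v i) * gram n L i j * v j)"
    unfolding quadratic_form_gram u_def[symmetric] by (simp add: complex_mult_cnj cmod_def)
  finally show "0 < Re (\<Sum>i<n. \<Sum>j<n. cnj (v i) * gram n L i j * v j)" .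
qed

lemma quadratic_form_diag:
  fixes v :: "nat \<Rightarrow> complex" and \<delta> :: "nat \<Rightarrow> real"
  shows "(\<Sum>i<n. \<Sum>j<n. cnj (v i) * (if i = j then of_real (\<delta> i) else 0) * v j) = (\<Sum>i<n. cnj (v i) * of_real (\<delta> i) * v i)"
proof (intro sum.cong refl)
  fix i :: nat assume i: "i \<in> {..<n}"
  have "(\<Sum>j<n. cnj (v i) * (if i = j then of_real (\<delta> i) else 0) * v j)
      = (\<Sum>j<n. if i = j then cnj (v i) * of_real (\<delta> i) * v i else 0)"
    by (intro sum.cong) auto
  also have "\<dots> = cnj (v i) * of_real (\<delta> i) * v i" using i by simp
  finally show "(\<Sum>j<n. cnj (v i) * (if i = j then of_real (\<delta> i) else 0) * v j) = cnj (v i) * of_real (\<delta> i) * v i" .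
qed

lemma back_substitution:
  fixes L :: "nat \<Rightarrow> nat \<Rightarrow> complex"
  assumes diag: "\<And>r. r < q \<Longrightarrow> L r r \<noteq> 0"
  shows "\<exists>v. (\<forall>i>q. v i = 0) \<and> v q = 1 \<and> (\<forall>r<q. (\<Sum>i\<in>{r..q}. cnj (v i) * L i r) = 0)"
proof -
  have "\<exists>v. (\<forall>i>q. v i = 0) \<and> v q = 1 \<and> (\<forall>r. q - t \<le> r \<and> r < q \<longrightarrow> (\<Sum>i\<in>{r..q}. cnj (v i) * L i r) = 0)"
    if "t \<le> q" for t
    using that
  proof (induction t)
    case 0
    show ?case by (rule exI[of _ "\<lambda>i. if i = q then 1 else 0"]) auto
  next
    case (Suc t)
    then obtain v where v: "\<forall>i>q. v i = 0" "v q = 1"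
      and solved: "\<forall>r. q - t \<le> r \<and> r < q \<longrightarrow> (\<Sum>i\<in>{r..q}. cnj (v i) * L i r) = 0" by auto
    define r0 where "r0 = q - Suc t"
    define X where "X = (\<Sum>i\<in>{r0<..q}. cnj (v i) * L i r0)"
    define v' where "v' = v(r0 := - cnj (X / L r0 r0))"
    have r0: "r0 < q" "L r0 r0 \<noteq> 0" using Suc.prems diag by (auto simp: r0_def)
    have "(\<Sum>i\<in>{r..q}. cnj (v' i) * L i r) = 0" if "q - Suc t \<le> r" "r < q" for r
    proof (cases "r = r0")
      case True
      have "{r0..q} = insert r0 {r0<..q}" using r0 by auto
      then have "(\<Sum>i\<in>{r0..q}. cnj (v' i) * L i r0) = cnj (v' r0) * L r0 r0 + X"
        by (simp add: X_def v'_def)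
      then show ?thesis using True r0 by (simp add: v'_def)
    next
      case False
      then have "(\<Sum>i\<in>{r..q}. cnj (v' i) * L i r) = (\<Sum>i\<in>{r..q}. cnj (v i) * L i r)"
        using that by (intro sum.cong) (auto simp: v'_def r0_def)
      with False that solved show ?thesis by (simp add: r0_def)
    qed
    moreover have "\<forall>i>q. v' i = 0" "v' q = 1" using v r0 by (auto simp: v'_def)
    ultimately show ?case by blast
  qed
  from this[of q] show ?thesis by auto
qed

lemma not_hermitian_pd_gram_plus_diag:
  fixes L :: "nat \<Rightarrow> nat \<Rightarrow> complex" and \<delta> :: "nat \<Rightarrow> real"
  assumes low: "\<And>i r. i < r \<Longrightarrow> L i r = 0" and diag: "\<And>r. r < q \<Longrightarrow> L r r \<noteq> 0"
    and q: "q < n" and \<delta>: "\<And>r. r < q \<Longrightarrow> \<delta> r = 0" and bad: "(cmod (L q q))\<^sup>2 + \<delta> q \<le> 0"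
  shows "\<not> hermitian_pd n (\<lambda>i j. gram n L i j + (if i = j then of_real (\<delta> i) else 0))"
proof
  obtain v where v: "\<And>i. q < i \<Longrightarrow> v i = 0" "v q = 1"
    and solved: "\<And>r. r < q \<Longrightarrow> (\<Sum>i\<in>{r..q}. cnj (v i) * L i r) = 0"
    using back_substitution[of q L, OF diag] by blast
  define u where "u r = (\<Sum>i<n. cnj (v i) * L i r)" for r
  have u: "u r = (\<Sum>i\<in>{r..q}. cnj (v i) * L i r)" for r
    unfolding u_def using q v low by (intro sum.mono_neutral_right) auto
  have "u r = 0" if "r \<noteq> q" for r
    using that solved by (cases "r < q") (simp_all add: u)
  then have "(\<Sum>r<n. u r * cnj (u r)) = u q * cnj (u q)"
    using q by (intro sum.eq_single) auto
  also have "\<dots> = L q q * cnj (L q q)"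
    using v by (simp add: u)
  finally have gram_part: "(\<Sum>r<n. u r * cnj (u r)) = L q q * cnj (L q q)" .
  have diag_part: "(\<Sum>i<n. \<Sum>j<n. cnj (v i) * (if i = j then of_real (\<delta> i) else 0) * v j) = of_real (\<delta> q)"
  proof -
    have "(\<Sum>i<n. cnj (v i) * of_real (\<delta> i) * v i) = cnj (v q) * of_real (\<delta> q) * v q"
      using q v \<delta> by (intro sum.eq_single) (auto simp: neq_iff)
    then show ?thesis using v by (simp add: quadratic_form_diag)
  qed
  assume pd: "hermitian_pd n (\<lambda>i j. gram n L i j + (if i = j then of_real (\<delta> i) else 0))"
  have "\<exists>i<n. v i \<noteq> 0" using q v by auto
  from pd[unfolded hermitian_pd_def, THEN conjunct2, rule_format, OF this]
  have "0 < Re (\<Sum>i<n. \<Sum>j<n. cnj (v i) * (gram n L i j + (if i = j then of_real (\<delta> i) else 0)) * v j)" .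
  also have "(\<Sum>i<n. \<Sum>j<n. cnj (v i) * (gram n L i j + (if i = j then of_real (\<delta> i) else 0)) * v j)
      = (\<Sum>i<n. \<Sum>j<n. cnj (v i) * gram n L i j * v j)
        + (\<Sum>i<n. \<Sum>j<n. cnj (v i) * (if i = j then of_real (\<delta> i) else 0) * v j)"
    by (simp add: distrib_left distrib_right sum.distrib)
  also have "\<dots> = L q q * cnj (L q q) + of_real (\<delta> q)"
    unfolding quadratic_form_gram u_def[symmetric] gram_part diag_part ..
  also have "Re \<dots> = (cmod (L q q))\<^sup>2 + \<delta> q"
    by (simp add: complex_mult_cnj cmod_power2)
  finally show False using bad by simp
qed

lemma cdet_eq_det: "cdet n M = det (mat n n (\<lambda>(i, j). M i j))"
proof -
  have "det (mat n n (\<lambda>(i, j). M i j)) = (\<Sum>p\<in>{p. p permutes {0..<n}}. signof p * (\<Prod>i=0..<n. mat n n (\<lambda>(i, j). M i j) $$ (i, p i)))"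
    by (rule det_def') simp
  also have "\<dots> = (\<Sum>p\<in>{p. p permutes {..<n}}. of_int (sign p) * (\<Prod>i<n. M i (p i)))"
  proof (intro sum.cong)
    show "{p. p permutes {0..<n}} = {p. p permutes {..<n}}" by (simp add: atLeast0LessThan)
  next
    fix p assume "p \<in> {p. p permutes {..<n}}"
    hence p: "p permutes {..<n}" by simp
    have "(\<Prod>i=0..<n. mat n n (\<lambda>(i, j). M i j) $$ (i, p i)) = (\<Prod>i<n. M i (p i))"
      by (simp only: atLeast0LessThan, rule prod.cong) (use permutes_in_image[OF p] in auto)
    thus "signof p * (\<Prod>i=0..<n. mat n n (\<lambda>(i, j). M i j) $$ (i, p i)) = of_int (sign p) * (\<Prod>i<n. M i (p i))"
      by simp
  qed
  finally show ?thesis unfolding cdet_def by simp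
qed

lemma cdet_gram:
  fixes L :: "nat \<Rightarrow> nat \<Rightarrow> complex"
  assumes low: "\<And>i r. i < r \<Longrightarrow> L i r = 0"
  shows "cdet n (gram n L) = (\<Prod>i<n. L i i * cnj (L i i))"
proof -
  define A where "A = mat n n (\<lambda>(i, j). L i j)"
  define B where "B = mat n n (\<lambda>(i, j). cnj (L j i))"
  have A: "A \<in> carrier_mat n n" and B: "B \<in> carrier_mat n n" by (auto simp: A_def B_def)
  have "mat n n (\<lambda>(i, j). gram n L i j) = A * B"
    by (rule eq_matI) (auto simp: A_def B_def gram_def scalar_prod_def atLeast0LessThan)
  moreover have "det A = (\<Prod>i<n. L i i)"
    using det_lower_triangular[OF _ A] low
    by (simp add: A_def diag_mat_def prod.distinct_set_conv_list[symmetric] atLeast0LessThan)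
  moreover have "det B = (\<Prod>i<n. cnj (L i i))"
    using det_upper_triangular[OF _ B] low
    by (simp add: B_def upper_triangular_def diag_mat_def prod.distinct_set_conv_list[symmetric]
        atLeast0LessThan)
  ultimately show ?thesis
    by (simp add: cdet_eq_det det_mult[OF A B] prod.distrib)
qed

section \<open>The Cholesky parametrization of correlation matrices\<close>

definition corr_row_index :: "nat \<Rightarrow> nat \<Rightarrow> (nat \<times> nat \<times> nat) set" where
  "corr_row_index \<beta> j = {(j', k, s). j' = j \<and> k < j \<and> s < \<beta>}"

abbreviation row_sq_norm :: "nat \<Rightarrow> (nat \<times> nat \<times> nat \<Rightarrow> real) \<Rightarrow> nat \<Rightarrow> real" where
  "row_sq_norm \<beta> w j \<equiv> sq_norm (corr_row_index \<beta> j) w"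

lemma corr_row_index_eq: "corr_row_index \<beta> j = (\<lambda>(k, s). (j, k, s)) ` ({..<j} \<times> {..<\<beta>})"
  by (auto simp: corr_row_index_def image_iff)

lemma finite_corr_row_index [simp]: "finite (corr_row_index \<beta> j)"
  unfolding corr_row_index_eq by simp

lemma card_corr_row_index: "card (corr_row_index \<beta> j) = \<beta> * j"
proof -
  have "inj_on (\<lambda>(k, s). (j, k, s)) ({..<j} \<times> {..<\<beta>})" by (auto simp: inj_on_def)
  then show ?thesis unfolding corr_row_index_eq by (simp add: card_image card_cartesian_product)
qed

lemma corr_index_eq_UN: "corr_index \<beta> N = (\<Union>j<N. corr_row_index \<beta> j)"
  by (auto simp: corr_index_def corr_row_index_def)

lemma finite_corr_index [simp]: "finite (corr_index \<beta> N)"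
  by (simp add: corr_index_eq_UN)

lemma row_sq_norm_eq: "row_sq_norm \<beta> w j = (\<Sum>k<j. \<Sum>s<\<beta>. (w (j, k, s))\<^sup>2)"
proof -
  have "inj_on (\<lambda>(k, s). (j, k, s)) ({..<j} \<times> {..<\<beta>})" by (auto simp: inj_on_def)
  then show ?thesis
    by (simp add: sq_norm_def corr_row_index_eq sum.reindex sum.cartesian_product case_prod_unfold)
qed

lemma nn_integral_corr_rows:
  assumes e: "\<And>j. e j > -1"
  shows "(\<integral>\<^sup>+w. (\<Prod>j<N. ball_weight (corr_row_index \<beta> j) (e j) w) \<partial>PiM (corr_index \<beta> N) (\<lambda>_. lborel))
         = ennreal (\<Prod>j<N. \<Prod>i<\<beta> * j. Beta (e j + 1 + real i / 2) (1/2))"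
proof -
  have "(\<integral>\<^sup>+w. (\<Prod>j<N. ball_weight (corr_row_index \<beta> j) (e j) w) \<partial>PiM (corr_index \<beta> N) (\<lambda>_. lborel))
      = (\<Prod>j<N. \<integral>\<^sup>+w. ball_weight (corr_row_index \<beta> j) (e j) w \<partial>PiM (corr_row_index \<beta> j) (\<lambda>_. lborel))"
    unfolding corr_index_eq_UN
    by (rule nn_integral_prod_blocks)
       (auto simp: disjoint_family_on_def corr_row_index_def intro: ball_weight_cong)
  also have "\<dots> = (\<Prod>j<N. ennreal (\<Prod>i<\<beta> * j. Beta (e j + 1 + real i / 2) (1/2)))"
    using e by (simp add: nn_integral_ball_weight card_corr_row_index)
  also have "\<dots> = ennreal (\<Prod>j<N. \<Prod>i<\<beta> * j. Beta (e j + 1 + real i / 2) (1/2))"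
  proof (intro prod_ennreal prod_nonneg less_imp_le Beta_real_pos)
    fix j i :: nat
    have "real i / 2 \<ge> 0" by simp
    with e[of j] show "0 < e j + 1 + real i / 2" by linarith
  qed simp
  finally show ?thesis .
qed

text \<open>For \<open>\<beta> = 4\<close> the complex index \<open>p\<close> of the \<open>2N \<times> 2N\<close> matrix lies in the quaternion block
  row \<open>p div 2\<close>; \<open>block_start \<beta> j\<close> is the first complex index of block row \<open>j\<close>.\<close>

definition block_of :: "nat \<Rightarrow> nat \<Rightarrow> nat" where
  "block_of \<beta> p = (if \<beta> = 4 then p div 2 else p)"

definition block_start :: "nat \<Rightarrow> nat \<Rightarrow> nat" where
  "block_start \<beta> j = (if \<beta> = 4 then 2 * j else j)"

lemma block_of_mono: "p \<le> q \<Longrightarrow> block_of \<beta> p \<le> block_of \<beta> q"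
  by (simp add: block_of_def div_le_mono)

lemma less_block_start_iff: "r < block_start \<beta> k \<longleftrightarrow> block_of \<beta> r < k"
  by (auto simp: block_of_def block_start_def)

lemma block_start_le_iff: "block_start \<beta> k \<le> r \<longleftrightarrow> k \<le> block_of \<beta> r"
  using less_block_start_iff[of r \<beta> k] by linarith

lemma block_start_block_of: "block_start \<beta> (block_of \<beta> q) \<le> q"
  by (simp add: block_of_def block_start_def)

lemma block_of_block_start [simp]: "block_of \<beta> (block_start \<beta> j) = j"
  by (simp add: block_of_def block_start_def)

lemma block_of_less_corr_size: "\<beta> \<in> {1, 2, 4} \<Longrightarrow> p < corr_size \<beta> N \<Longrightarrow> block_of \<beta> p < N"
  by (auto simp: block_of_def corr_size_def)

lemma block_start_less_corr_size: "\<beta> \<in> {1, 2, 4} \<Longrightarrow> j < N \<Longrightarrow> block_start \<beta> j < corr_size \<beta> N"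
  by (auto simp: block_start_def corr_size_def)

text \<open>The Cholesky factor \<open>L\<close> of \<open>R = L L\<^sup>*\<close>: block row \<open>j\<close> of \<open>L\<close> carries the coordinates of
  row \<open>j\<close> of \<open>w\<close> left of the diagonal block and \<open>sqrt (1 - |w\<^sub>j|\<^sup>2)\<close> on the diagonal.
  The junk value 1 outside the unit ball keeps the diagonal positive.\<close>

definition chol_entry :: "nat \<Rightarrow> (nat \<times> nat \<times> nat \<Rightarrow> real) \<Rightarrow> nat \<Rightarrow> nat \<Rightarrow> complex" where
  "chol_entry \<beta> w p q =
    (if \<beta> = 4 then low_block w (p div 2) (q div 2) (p mod 2) (q mod 2) else low_entry \<beta> w p q)"

definition chol_diag :: "nat \<Rightarrow> (nat \<times> nat \<times> nat \<Rightarrow> real) \<Rightarrow> nat \<Rightarrow> real" where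
  "chol_diag \<beta> w j = (if row_sq_norm \<beta> w j < 1 then sqrt (1 - row_sq_norm \<beta> w j) else 1)"

definition chol_factor :: "nat \<Rightarrow> (nat \<times> nat \<times> nat \<Rightarrow> real) \<Rightarrow> nat \<Rightarrow> nat \<Rightarrow> complex" where
  "chol_factor \<beta> w p q =
    (if block_of \<beta> q < block_of \<beta> p then chol_entry \<beta> w p q
     else if p = q then of_real (chol_diag \<beta> w (block_of \<beta> p)) else 0)"

definition chol_inner :: "nat \<Rightarrow> (nat \<times> nat \<times> nat \<Rightarrow> real) \<Rightarrow> nat \<Rightarrow> nat \<Rightarrow> complex" where
  "chol_inner \<beta> w p q = (\<Sum>r<block_start \<beta> (block_of \<beta> q). chol_entry \<beta> w p r * cnj (chol_entry \<beta> w q r))"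

definition complex_coord :: "nat \<Rightarrow> complex \<Rightarrow> real" where
  "complex_coord s z = (if even s then Re z else Im z)"

definition chol_shift :: "nat \<Rightarrow> (nat \<times> nat \<times> nat \<Rightarrow> real) \<Rightarrow> nat \<times> nat \<times> nat \<Rightarrow> real" where
  "chol_shift \<beta> w i =
    (case i of (j, k, s) \<Rightarrow> complex_coord s (chol_inner \<beta> w (block_start \<beta> j) (block_start \<beta> k + s div 2)))"

definition chol_to_corr :: "nat \<Rightarrow> nat \<Rightarrow> (nat \<times> nat \<times> nat \<Rightarrow> real) \<Rightarrow> nat \<times> nat \<times> nat \<Rightarrow> real" where
  "chol_to_corr \<beta> N =
    triangular_affine (corr_index \<beta> N) (\<lambda>i w. chol_diag \<beta> w (fst (snd i))) (\<lambda>i w. chol_shift \<beta> w i)"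

definition diag_defect :: "nat \<Rightarrow> (nat \<times> nat \<times> nat \<Rightarrow> real) \<Rightarrow> nat \<Rightarrow> real" where
  "diag_defect \<beta> w p = 1 - row_sq_norm \<beta> w (block_of \<beta> p) - (chol_diag \<beta> w (block_of \<beta> p))\<^sup>2"

lemma chol_diag_pos: "chol_diag \<beta> w j > 0"
  by (simp add: chol_diag_def)

lemma chol_diag_squared: "row_sq_norm \<beta> w j < 1 \<Longrightarrow> (chol_diag \<beta> w j)\<^sup>2 = 1 - row_sq_norm \<beta> w j"
  by (simp add: chol_diag_def)

lemma chol_factor_upper: "i < r \<Longrightarrow> chol_factor \<beta> w i r = 0"
  using block_of_mono[of i r \<beta>] by (auto simp: chol_factor_def)

lemma chol_factor_diag: "chol_factor \<beta> w r r = of_real (chol_diag \<beta> w (block_of \<beta> r))"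
  by (simp add: chol_factor_def)

lemma chol_to_corr_coord:
  "(j, k, s) \<in> corr_index \<beta> N \<Longrightarrow> chol_to_corr \<beta> N w (j, k, s)
     = chol_diag \<beta> w k * w (j, k, s) + complex_coord s (chol_inner \<beta> w (block_start \<beta> j) (block_start \<beta> k + s div 2))"
  by (simp add: chol_to_corr_def triangular_affine_def chol_shift_def)

lemma gram_chol_factor:
  assumes "block_of \<beta> q \<le> block_of \<beta> p" "q < n"
  shows "gram n (chol_factor \<beta> w) p q
           = chol_inner \<beta> w p q + chol_factor \<beta> w p q * of_real (chol_diag \<beta> w (block_of \<beta> q))"
proof -
  define c where "c = block_start \<beta> (block_of \<beta> q)"
  have cq: "c \<le> q" unfolding c_def by (rule block_start_block_of)
  have "gram n (chol_factor \<beta> w) p q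
      = (\<Sum>r\<in>{..<n} - {..<c}. chol_factor \<beta> w p r * cnj (chol_factor \<beta> w q r))
        + (\<Sum>r<c. chol_factor \<beta> w p r * cnj (chol_factor \<beta> w q r))"
    unfolding gram_def using cq assms by (intro sum.subset_diff) auto
  also have "(\<Sum>r<c. chol_factor \<beta> w p r * cnj (chol_factor \<beta> w q r)) = chol_inner \<beta> w p q"
    unfolding chol_inner_def c_def[symmetric] using assms(1)
    by (intro sum.cong) (auto simp: c_def less_block_start_iff chol_factor_def)
  also have "(\<Sum>r\<in>{..<n} - {..<c}. chol_factor \<beta> w p r * cnj (chol_factor \<beta> w q r))
      = chol_factor \<beta> w p q * cnj (chol_factor \<beta> w q q)"
    by (rule sum.eq_single) (use cq assms in \<open>auto simp: c_def block_start_le_iff chol_factor_def\<close>)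
  finally show ?thesis by (simp add: chol_factor_diag)
qed

lemma chol_inner_diag:
  assumes "\<beta> \<in> {1, 2, 4}"
  shows "chol_inner \<beta> w p p = of_real (row_sq_norm \<beta> w (block_of \<beta> p))"
proof -
  consider "\<beta> = 1" | "\<beta> = 2" | "\<beta> = 4" using assms by auto
  then show ?thesis
  proof cases
    case 1
    then show ?thesis
      by (simp add: chol_inner_def row_sq_norm_eq block_of_def block_start_def chol_entry_def
          low_entry_def complex_mult_cnj)
  next
    case 2
    have "{..<2::nat} = {0, 1}" by auto
    with 2 show ?thesis
      by (simp add: chol_inner_def row_sq_norm_eq block_of_def block_start_def chol_entry_def
          low_entry_def complex_mult_cnj)
  next
    case 3
    define j a where "j = p div 2" and "a = p mod 2"
    have "a = 0 \<or> a = 1" by (auto simp: a_def)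
    then have "chol_entry 4 w p (2 * m) * cnj (chol_entry 4 w p (2 * m)) + chol_entry 4 w p (2 * m + 1) * cnj (chol_entry 4 w p (2 * m + 1))
        = of_real ((w (j, m, 0))\<^sup>2 + (w (j, m, 1))\<^sup>2 + (w (j, m, 2))\<^sup>2 + (w (j, m, 3))\<^sup>2)" for m
      by (auto simp: chol_entry_def j_def[symmetric] a_def[symmetric] low_block_def Let_def
          complex_mult_cnj algebra_simps)
    moreover have "{..<4::nat} = {0, 1, 2, 3}" by auto
    ultimately show ?thesis
      using 3 by (simp add: chol_inner_def block_of_def block_start_def j_def sum.lessThan_double
          row_sq_norm_eq add.assoc)
  qed
qed

lemma chol_inner_quaternion:
  assumes "a < 2" "b < 2"
  shows "chol_inner 4 w (2 * j + a) (2 * k + b)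
    = (\<Sum>m<k. low_block w j m a 0 * cnj (low_block w k m b 0) + low_block w j m a 1 * cnj (low_block w k m b 1))"
  using assms by (simp add: chol_inner_def block_of_def block_start_def sum.lessThan_double chol_entry_def)

lemma chol_inner_quaternion_conj:
  "chol_inner 4 w (2 * j + 1) (2 * k + 1) = cnj (chol_inner 4 w (2 * j) (2 * k))"
  using chol_inner_quaternion[of 1 1 w j k] chol_inner_quaternion[of 0 0 w j k]
  by (simp add: low_block_def Let_def ac_simps)

lemma chol_inner_quaternion_neg_conj:
  "chol_inner 4 w (2 * j + 1) (2 * k) = - cnj (chol_inner 4 w (2 * j) (2 * k + 1))"
  using chol_inner_quaternion[of 1 0 w j k] chol_inner_quaternion[of 0 1 w j k]
  by (simp add: low_block_def Let_def sum_negf[symmetric] algebra_simps)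

lemma chol_inner_quaternion_diag_block: "chol_inner 4 w (2 * j) (2 * j + 1) = 0"
  using chol_inner_quaternion[of 0 1 w j j] by (simp add: low_block_def Let_def algebra_simps)

lemma corr_mat_chol_to_corr_below_complex:
  assumes \<beta>: "\<beta> = 1 \<or> \<beta> = 2" and "q < p" "p < N"
  shows "corr_mat \<beta> N (chol_to_corr \<beta> N w) p q
           = chol_inner \<beta> w p q + chol_entry \<beta> w p q * of_real (chol_diag \<beta> w q)"
proof -
  have T: "chol_to_corr \<beta> N w (p, q, s) = chol_diag \<beta> w q * w (p, q, s) + complex_coord s (chol_inner \<beta> w p q)"
    if "s < \<beta>" for s
    using assms that by (auto simp: chol_to_corr_coord corr_index_def block_start_def)
  have "Im (chol_inner 1 w p q) = 0" by (simp add: chol_inner_def chol_entry_def low_entry_def)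
  then show ?thesis
    using assms T[of 0] T[of 1]
    by (auto simp: corr_mat_def low_entry_def chol_entry_def complex_eq_iff complex_coord_def algebra_simps)
qed

lemma corr_mat_chol_to_corr_below_quaternion:
  assumes "k < j" "j < N" and ab: "a < 2" "b < 2"
  shows "corr_mat 4 N (chol_to_corr 4 N w) (2 * j + a) (2 * k + b)
           = chol_inner 4 w (2 * j + a) (2 * k + b) + low_block w j k a b * of_real (chol_diag 4 w k)"
proof -
  have T: "chol_to_corr 4 N w (j, k, s) = chol_diag 4 w k * w (j, k, s) + complex_coord s (chol_inner 4 w (2 * j) (2 * k + s div 2))"
    if "s < 4" for s
    using assms that by (simp add: chol_to_corr_coord corr_index_def block_start_def)
  have "a = 0 \<or> a = 1" "b = 0 \<or> b = 1" using ab by auto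
  then show ?thesis
    using assms T[of 0] T[of 1] T[of 2] T[of 3]
      chol_inner_quaternion_conj[of w j k] chol_inner_quaternion_neg_conj[of w j k]
    by (auto simp: corr_mat_def low_block_def Let_def complex_eq_iff complex_coord_def algebra_simps)
qed

lemma corr_mat_chol_to_corr_below:
  assumes \<beta>: "\<beta> \<in> {1, 2, 4}" and p: "p < corr_size \<beta> N" and pq: "block_of \<beta> q < block_of \<beta> p"
  shows "corr_mat \<beta> N (chol_to_corr \<beta> N w) p q = gram (corr_size \<beta> N) (chol_factor \<beta> w) p q"
proof -
  have "q < p" using pq block_of_mono[of p q \<beta>] by linarith
  then have gram: "gram (corr_size \<beta> N) (chol_factor \<beta> w) p q
      = chol_inner \<beta> w p q + chol_entry \<beta> w p q * of_real (chol_diag \<beta> w (block_of \<beta> q))"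
    using gram_chol_factor[of \<beta> q p] pq p by (simp add: chol_factor_def)
  show ?thesis
  proof (cases "\<beta> = 4")
    case True
    define j a k b where "j = p div 2" "a = p mod 2" "k = q div 2" "b = q mod 2"
    have "p = 2 * j + a" "q = 2 * k + b" "a < 2" "b < 2" "k < j" "j < N"
      using True pq p by (auto simp: j_a_k_b_def block_of_def corr_size_def)
    then show ?thesis
      using corr_mat_chol_to_corr_below_quaternion[of k j N a b w] gram True
      by (simp add: chol_entry_def block_of_def)
  next
    case False
    then show ?thesis
      using corr_mat_chol_to_corr_below_complex[of \<beta> q p N w] gram \<beta> \<open>q < p\<close> p
      by (auto simp: block_of_def corr_size_def)
  qed
qed

lemma corr_mat_chol_to_corr_same_block:
  assumes pq: "block_of \<beta> p = block_of \<beta> q" "p \<noteq> q" and q: "q < corr_size \<beta> N"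
  shows "corr_mat \<beta> N (chol_to_corr \<beta> N w) p q = 0" "gram (corr_size \<beta> N) (chol_factor \<beta> w) p q = 0"
proof -
  have "\<beta> = 4" using pq by (auto simp: block_of_def split: if_splits)
  define j where "j = p div 2"
  have "(p = 2 * j \<and> q = 2 * j + 1) \<or> (p = 2 * j + 1 \<and> q = 2 * j)"
    using pq \<open>\<beta> = 4\<close> unfolding j_def block_of_def by auto
  then have "chol_inner \<beta> w p q = 0"
    using \<open>\<beta> = 4\<close> chol_inner_quaternion_diag_block[of w j] chol_inner_quaternion_neg_conj[of w j j] by auto
  then show "gram (corr_size \<beta> N) (chol_factor \<beta> w) p q = 0"
    using gram_chol_factor[of \<beta> q p] pq q by (simp add: chol_factor_def)
  show "corr_mat \<beta> N (chol_to_corr \<beta> N w) p q = 0"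
    using pq \<open>\<beta> = 4\<close> by (auto simp: corr_mat_def Let_def block_of_def) (metis div_mult_mod_eq)
qed

lemma corr_mat_chol_to_corr:
  assumes \<beta>: "\<beta> \<in> {1, 2, 4}" and p: "p < corr_size \<beta> N" and q: "q < corr_size \<beta> N"
  shows "corr_mat \<beta> N (chol_to_corr \<beta> N w) p q
           = gram (corr_size \<beta> N) (chol_factor \<beta> w) p q + (if p = q then of_real (diag_defect \<beta> w p) else 0)"
proof -
  let ?n = "corr_size \<beta> N"
  consider "block_of \<beta> q < block_of \<beta> p" | "block_of \<beta> p < block_of \<beta> q" | "p = q"
    | "block_of \<beta> p = block_of \<beta> q" "p \<noteq> q"
    by linarith
  then show ?thesis
  proof cases
    case 1
    then show ?thesis using corr_mat_chol_to_corr_below[OF \<beta> p] by auto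
  next
    case 2
    have "corr_mat \<beta> N (chol_to_corr \<beta> N w) p q = cnj (corr_mat \<beta> N (chol_to_corr \<beta> N w) q p)"
      by (auto simp: corr_mat_def Let_def)
    also have "\<dots> = gram ?n (chol_factor \<beta> w) p q"
      using corr_mat_chol_to_corr_below[OF \<beta> q 2] by (simp add: gram_swap[of _ _ p q])
    finally show ?thesis using 2 by auto
  next
    case 3
    have "gram ?n (chol_factor \<beta> w) p p = of_real (row_sq_norm \<beta> w (block_of \<beta> p) + (chol_diag \<beta> w (block_of \<beta> p))\<^sup>2)"
      using gram_chol_factor[of \<beta> p p] p chol_inner_diag[OF \<beta>] by (simp add: chol_factor_diag power2_eq_square)
    then show ?thesis using 3 by (simp add: corr_mat_def Let_def diag_defect_def)
  next
    case 4
    then show ?thesis using corr_mat_chol_to_corr_same_block[OF 4 q] by simp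
  qed
qed

lemma corr_mat_chol_to_corr_in_ball:
  assumes \<beta>: "\<beta> \<in> {1, 2, 4}" and ball: "\<forall>j<N. row_sq_norm \<beta> w j < 1"
    and "p < corr_size \<beta> N" "q < corr_size \<beta> N"
  shows "corr_mat \<beta> N (chol_to_corr \<beta> N w) p q = gram (corr_size \<beta> N) (chol_factor \<beta> w) p q"
proof -
  have "diag_defect \<beta> w p = 0"
    using assms block_of_less_corr_size[OF \<beta>] chol_diag_squared by (simp add: diag_defect_def)
  then show ?thesis using corr_mat_chol_to_corr[OF assms(1,3,4)] by (cases "p = q") simp_all
qed

lemma chol_to_corr_in_corr_set:
  assumes \<beta>: "\<beta> \<in> {1, 2, 4}" and ball: "\<forall>j<N. row_sq_norm \<beta> w j < 1"
  shows "chol_to_corr \<beta> N w \<in> corr_set \<beta> N"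
proof -
  have "hermitian_pd (corr_size \<beta> N) (gram (corr_size \<beta> N) (chol_factor \<beta> w))"
    using chol_diag_pos[THEN less_imp_neq] by (intro hermitian_pd_gram) (auto simp: chol_factor_upper chol_factor_diag)
  then show ?thesis
    unfolding corr_set_def
    using hermitian_pd_cong[of "corr_size \<beta> N" "corr_mat \<beta> N (chol_to_corr \<beta> N w)"]
      corr_mat_chol_to_corr_in_ball[OF assms] by simp
qed

lemma corr_det_chol_to_corr:
  assumes \<beta>: "\<beta> \<in> {1, 2, 4}" and ball: "\<forall>j<N. row_sq_norm \<beta> w j < 1"
  shows "corr_det \<beta> N (chol_to_corr \<beta> N w) = (\<Prod>j<N. 1 - row_sq_norm \<beta> w j)"
proof -
  let ?n = "corr_size \<beta> N"
  have "cdet ?n (corr_mat \<beta> N (chol_to_corr \<beta> N w)) = cdet ?n (gram ?n (chol_factor \<beta> w))"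
    by (rule cdet_cong) (rule corr_mat_chol_to_corr_in_ball[OF assms])
  also have "\<dots> = (\<Prod>p<?n. chol_factor \<beta> w p p * cnj (chol_factor \<beta> w p p))"
    by (rule cdet_gram) (rule chol_factor_upper)
  also have "\<dots> = (\<Prod>p<?n. of_real (1 - row_sq_norm \<beta> w (block_of \<beta> p)))"
  proof (intro prod.cong refl)
    fix p assume "p \<in> {..<?n}"
    then have "(chol_diag \<beta> w (block_of \<beta> p))\<^sup>2 = 1 - row_sq_norm \<beta> w (block_of \<beta> p)"
      using ball block_of_less_corr_size[OF \<beta>] chol_diag_squared by simp
    then show "chol_factor \<beta> w p p * cnj (chol_factor \<beta> w p p) = of_real (1 - row_sq_norm \<beta> w (block_of \<beta> p))"
      by (simp add: chol_factor_diag power2_eq_square flip: of_real_mult)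
  qed
  finally have cdet: "cdet ?n (corr_mat \<beta> N (chol_to_corr \<beta> N w))
      = of_real (\<Prod>p<?n. 1 - row_sq_norm \<beta> w (block_of \<beta> p))" by simp
  show ?thesis
  proof (cases "\<beta> = 4")
    case True
    \<comment> \<open>each quaternion row contributes two equal complex diagonal factors\<close>
    have "(\<Prod>p<?n. 1 - row_sq_norm \<beta> w (block_of \<beta> p)) = (\<Prod>j<N. 1 - row_sq_norm \<beta> w j)\<^sup>2"
      using True by (simp add: corr_size_def block_of_def prod.lessThan_double power2_eq_square prod.distrib)
    then have "Re (cdet ?n (corr_mat \<beta> N (chol_to_corr \<beta> N w))) = (\<Prod>j<N. 1 - row_sq_norm \<beta> w j)\<^sup>2"
      unfolding cdet by (simp only: Re_complex_of_real)
    moreover have "(\<Prod>j<N. 1 - row_sq_norm \<beta> w j) \<ge> 0" using ball by (intro prod_nonneg) auto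
    ultimately show ?thesis using True by (simp add: corr_det_def Let_def)
  next
    case False
    then have "(\<Prod>p<?n. 1 - row_sq_norm \<beta> w (block_of \<beta> p)) = (\<Prod>j<N. 1 - row_sq_norm \<beta> w j)"
      by (simp add: corr_size_def block_of_def)
    then have "Re (cdet ?n (corr_mat \<beta> N (chol_to_corr \<beta> N w))) = (\<Prod>j<N. 1 - row_sq_norm \<beta> w j)"
      unfolding cdet by (simp only: Re_complex_of_real)
    with False show ?thesis by (simp add: corr_det_def Let_def)
  qed
qed

lemma chol_to_corr_notin_corr_set:
  assumes \<beta>: "\<beta> \<in> {1, 2, 4}" and outside: "\<not> (\<forall>j<N. row_sq_norm \<beta> w j < 1)"
  shows "chol_to_corr \<beta> N w \<notin> corr_set \<beta> N"
proof
  let ?n = "corr_size \<beta> N"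
  obtain j0 where j0: "j0 < N" "\<not> row_sq_norm \<beta> w j0 < 1" and least: "\<And>j. j < j0 \<Longrightarrow> row_sq_norm \<beta> w j < 1"
    using outside exists_least_iff[of "\<lambda>j. j < N \<and> \<not> row_sq_norm \<beta> w j < 1"] by (metis less_trans)
  define q where "q = block_start \<beta> j0"
  \<comment> \<open>the leading rows are still a Gram matrix, but the diagonal entry of row \<open>j0\<close> is too small\<close>
  have "\<not> hermitian_pd ?n (\<lambda>i j. gram ?n (chol_factor \<beta> w) i j + (if i = j then of_real (diag_defect \<beta> w i) else 0))"
  proof (rule not_hermitian_pd_gram_plus_diag)
    show "q < ?n" unfolding q_def by (rule block_start_less_corr_size[OF \<beta> j0(1)])
    show "diag_defect \<beta> w r = 0" if "r < q" for r
      using that least chol_diag_squared by (simp add: diag_defect_def q_def less_block_start_iff)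
    show "(cmod (chol_factor \<beta> w q q))\<^sup>2 + diag_defect \<beta> w q \<le> 0"
      using j0 by (simp add: diag_defect_def q_def chol_factor_diag)
    show "chol_factor \<beta> w i r = 0" if "i < r" for i r using that by (rule chol_factor_upper)
    show "chol_factor \<beta> w r r \<noteq> 0" for r
      using chol_diag_pos[of \<beta> w "block_of \<beta> r"] by (simp add: chol_factor_diag)
  qed
  moreover assume "chol_to_corr \<beta> N w \<in> corr_set \<beta> N"
  then have "hermitian_pd ?n (\<lambda>i j. gram ?n (chol_factor \<beta> w) i j + (if i = j then of_real (diag_defect \<beta> w i) else 0))"
    using hermitian_pd_cong[of ?n "corr_mat \<beta> N (chol_to_corr \<beta> N w)"] corr_mat_chol_to_corr[OF \<beta>]
    by (simp add: corr_set_def)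
  ultimately show False by simp
qed

text \<open>Coordinates are ranked column by column, so that the coefficients of entry \<open>(j, k, s)\<close>,
  which only involve columns \<open>< k\<close> of \<open>w\<close>, depend on coordinates of lower rank.\<close>

definition chol_rank :: "nat \<Rightarrow> nat \<times> nat \<times> nat \<Rightarrow> nat" where
  "chol_rank N i = (case i of (j, k, s) \<Rightarrow> (k * N + j) * 4 + s)"

lemma inj_on_chol_rank:
  assumes "\<beta> \<in> {1, 2, 4}"
  shows "inj_on (chol_rank N) (corr_index \<beta> N)"
proof (rule inj_onI)
  fix x y assume "x \<in> corr_index \<beta> N" "y \<in> corr_index \<beta> N" and "chol_rank N x = chol_rank N y"
  moreover obtain j k s j' k' s' where xy: "x = (j, k, s)" "y = (j', k', s')" by (cases x, cases y)
  ultimately have "(j, k, s) \<in> corr_index \<beta> N" "(j', k', s') \<in> corr_index \<beta> N"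
    and eq: "chol_rank N (j, k, s) = chol_rank N (j', k', s')" by simp_all
  then have lt: "j < N" "j' < N" "s < 4" "s' < 4" using assms by (auto simp: corr_index_def)
  from eq have eq': "(k * N + j) * 4 + s = (k' * N + j') * 4 + s'" by (simp add: chol_rank_def)
  have digits: "(x * b + t) mod b = t" "(x * b + t) div b = x" if "t < b" for x t b :: nat
    using that by simp_all
  from eq' digits[of s 4 "k * N + j"] digits[of s' 4 "k' * N + j'"] lt
  have "s = s'" and jk: "k * N + j = k' * N + j'" by metis+
  from jk digits[of j N k] digits[of j' N k'] lt
  have "j = j'" "k = k'" by (metis mult.commute)+
  with \<open>s = s'\<close> show "x = y" by (simp add: xy)
qed

lemma chol_rank_less:
  assumes "m < k" "j' < N" "s' < 4"
  shows "chol_rank N (j', m, s') < chol_rank N (j, k, s)"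
proof -
  have "Suc m * N \<le> k * N" using assms by (intro mult_le_mono1) simp
  then have "(Suc m * N) * 4 \<le> (k * N) * 4" by (rule mult_le_mono1)
  then have "(Suc m * N) * 4 \<le> (k * N + j) * 4 + s" by (simp add: algebra_simps)
  moreover have "(m * N + j') * 4 + s' < (Suc m * N) * 4" using assms by simp
  ultimately show ?thesis by (simp add: chol_rank_def)
qed

lemma chol_entry_cong:
  assumes "\<beta> \<in> {1, 2, 4}"
    and "\<And>s. s < \<beta> \<Longrightarrow> w (block_of \<beta> p, block_of \<beta> r, s) = w' (block_of \<beta> p, block_of \<beta> r, s)"
  shows "chol_entry \<beta> w p r = chol_entry \<beta> w' p r"
  using assms(1) assms(2)[of 0] assms(2)[of 1] assms(2)[of 2] assms(2)[of 3]
  by (auto simp: chol_entry_def low_entry_def low_block_def block_of_def Let_def)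

lemma chol_coeffs_depend_on_lower:
  assumes \<beta>: "\<beta> \<in> {1, 2, 4}" and i: "(j, k, s) \<in> corr_index \<beta> N"
    and agree: "\<And>i'. i' \<in> corr_index \<beta> N \<Longrightarrow> chol_rank N i' < chol_rank N (j, k, s) \<Longrightarrow> w i' = w' i'"
  shows "chol_diag \<beta> w k = chol_diag \<beta> w' k \<and> chol_shift \<beta> w (j, k, s) = chol_shift \<beta> w' (j, k, s)"
proof -
  have kj: "k < j" "j < N" using i by (auto simp: corr_index_def)
  have lower: "w (j', m, s') = w' (j', m, s')" if "j' < N" "m < k" "m < j'" "s' < \<beta>" for j' m s'
    using that \<beta> by (intro agree chol_rank_less) (auto simp: corr_index_def)
  have "row_sq_norm \<beta> w k = row_sq_norm \<beta> w' k"
    using lower kj by (simp add: row_sq_norm_eq)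
  then have "chol_diag \<beta> w k = chol_diag \<beta> w' k" by (simp add: chol_diag_def)
  moreover have "chol_entry \<beta> w p r = chol_entry \<beta> w' p r"
    if "block_of \<beta> p = j \<or> block_of \<beta> p = k" "r < block_start \<beta> k" for p r
    using that kj \<beta> by (intro chol_entry_cong lower) (auto simp: less_block_start_iff)
  moreover have "block_of \<beta> (block_start \<beta> k + s div 2) = k"
    using i \<beta> by (auto simp: corr_index_def block_of_def block_start_def)
  ultimately show ?thesis
    by (simp add: chol_shift_def chol_inner_def)
qed

lemma borel_measurable_chol_diag [measurable]:
  "(\<lambda>w. chol_diag \<beta> w k) \<in> borel_measurable (PiM J (\<lambda>_. lborel))"
  unfolding chol_diag_def by measurable

lemma borel_measurable_Complex:
  "f \<in> borel_measurable M \<Longrightarrow> g \<in> borel_measurable M \<Longrightarrow> (\<lambda>x. Complex (f x) (g x)) \<in> borel_measurable M"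
  by (simp add: borel_measurable_complex_iff)

lemma borel_measurable_cnj:
  "f \<in> borel_measurable M \<Longrightarrow> (\<lambda>x. cnj (f x)) \<in> borel_measurable M"
  by (simp add: borel_measurable_complex_iff borel_measurable_uminus)

lemma borel_measurable_chol_entry:
  "(\<lambda>w. chol_entry \<beta> w p r) \<in> borel_measurable (PiM J (\<lambda>_. lborel))"
proof -
  have coord: "(\<lambda>w. Complex (w x) (w y)) \<in> borel_measurable (PiM J (\<lambda>_. lborel))" for x y
    by (intro borel_measurable_Complex measurable_coordinate)
  show ?thesis
  proof (cases "\<beta> = 4")
    case True
    then show ?thesis unfolding chol_entry_def low_block_def Let_def
      by (cases "p mod 2 = 0"; cases "r mod 2 = 0") (simp_all add: coord borel_measurable_uminus borel_measurable_cnj)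
  next
    case False
    then show ?thesis unfolding chol_entry_def low_entry_def
      by (cases "\<beta> = 2") (auto intro!: borel_measurable_Complex measurable_coordinate)
  qed
qed

lemma borel_measurable_chol_shift:
  "(\<lambda>w. chol_shift \<beta> w i) \<in> borel_measurable (PiM J (\<lambda>_. lborel))"
proof -
  have "(\<lambda>w. chol_inner \<beta> w p q) \<in> borel_measurable (PiM J (\<lambda>_. lborel))" for p q
    unfolding chol_inner_def
    by (intro borel_measurable_sum borel_measurable_times borel_measurable_cnj borel_measurable_chol_entry)
  then have "(\<lambda>w. Re (chol_inner \<beta> w p q)) \<in> borel_measurable (PiM J (\<lambda>_. lborel))"
    "(\<lambda>w. Im (chol_inner \<beta> w p q)) \<in> borel_measurable (PiM J (\<lambda>_. lborel))" for p q
    by (simp_all add: borel_measurable_complex_iff)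
  moreover obtain j k s where "i = (j, k, s)" by (cases i)
  ultimately show ?thesis
    by (cases "even s") (simp_all add: chol_shift_def complex_coord_def)
qed

lemma triangular_coeffs_chol:
  assumes "\<beta> \<in> {1, 2, 4}"
  shows "triangular_coeffs (corr_index \<beta> N) (chol_rank N) (\<lambda>i w. chol_diag \<beta> w (fst (snd i)))
           (\<lambda>i w. chol_shift \<beta> w i)"
proof
  fix i and w w' :: "nat \<times> nat \<times> nat \<Rightarrow> real" assume i: "i \<in> corr_index \<beta> N"
    and agree: "\<And>j. j \<in> corr_index \<beta> N \<Longrightarrow> chol_rank N j < chol_rank N i \<Longrightarrow> w j = w' j"
  obtain j k s where ijks: "i = (j, k, s)" by (cases i)
  have "chol_diag \<beta> w k = chol_diag \<beta> w' k \<and> chol_shift \<beta> w (j, k, s) = chol_shift \<beta> w' (j, k, s)"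
    using i agree unfolding ijks by (rule chol_coeffs_depend_on_lower[OF assms])
  then show "chol_diag \<beta> w (fst (snd i)) = chol_diag \<beta> w' (fst (snd i)) \<and> chol_shift \<beta> w i = chol_shift \<beta> w' i"
    by (simp add: ijks)
qed (simp_all only: finite_corr_index inj_on_chol_rank[OF assms] chol_diag_pos borel_measurable_chol_diag
     borel_measurable_chol_shift)

lemma prod_corr_index_column:
  "(\<Prod>i\<in>corr_index \<beta> N. f (fst (snd i))) = (\<Prod>k<N. f k ^ ((N - Suc k) * \<beta>))"
proof -
  have eq: "corr_index \<beta> N = (\<lambda>(k, j, s). (j, k, s)) ` (SIGMA k:{..<N}. {k<..<N} \<times> {..<\<beta>})"
    by (auto simp: corr_index_def image_iff)
  have "inj_on (\<lambda>(k, j, s). (j, k, s)) (SIGMA k:{..<N}. {k<..<N} \<times> {..<\<beta>})"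
    by (auto simp: inj_on_def)
  then have "(\<Prod>i\<in>corr_index \<beta> N. f (fst (snd i))) = (\<Prod>x\<in>(SIGMA k:{..<N}. {k<..<N} \<times> {..<\<beta>}). f (fst x))"
    unfolding eq by (subst prod.reindex) (simp_all add: comp_def case_prod_unfold)
  also have "\<dots> = (\<Prod>(k, y)\<in>(SIGMA k:{..<N}. {k<..<N} \<times> {..<\<beta>}). f k)"
    by (simp add: case_prod_unfold)
  also have "\<dots> = (\<Prod>k<N. \<Prod>y\<in>{k<..<N} \<times> {..<\<beta>}. f k)"
    by (rule prod.Sigma[symmetric]) auto
  finally show ?thesis by (simp add: card_cartesian_product)
qed

lemma prod_ball_weight_in_ball:
  "\<forall>j<N. row_sq_norm \<beta> w j < 1 \<Longrightarrow>
    (\<Prod>j<N. ball_weight (corr_row_index \<beta> j) (e j) w) = ennreal (\<Prod>j<N. (1 - row_sq_norm \<beta> w j) powr e j)"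
  by (simp add: ball_weight_def prod_ennreal)

lemma prod_ball_weight_outside:
  "\<not> (\<forall>j<N. row_sq_norm \<beta> w j < 1) \<Longrightarrow> (\<Prod>j<N. ball_weight (corr_row_index \<beta> j) (e j) w) = 0"
  by (auto simp: ball_weight_def)

lemma corr_integrand_chol_to_corr:
  assumes "\<beta> \<in> {1, 2, 4}"
  shows "indicator (corr_set \<beta> N) (chol_to_corr \<beta> N w) * ennreal (corr_det \<beta> N (chol_to_corr \<beta> N w) powr a)
       = (\<Prod>j<N. ball_weight (corr_row_index \<beta> j) a w)"
proof (cases "\<forall>j<N. row_sq_norm \<beta> w j < 1")
  case True
  then show ?thesis
    using chol_to_corr_in_corr_set[OF assms True] corr_det_chol_to_corr[OF assms True]
    by (simp add: prod_ball_weight_in_ball prod_powr_distrib)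
next
  case False
  then show ?thesis using chol_to_corr_notin_corr_set[OF assms False] prod_ball_weight_outside by simp
qed

lemma corr_integrand_chol_to_corr_jacobian:
  assumes \<beta>: "\<beta> \<in> {1, 2, 4}"
  shows "indicator (corr_set \<beta> N) (chol_to_corr \<beta> N w) * ennreal (corr_det \<beta> N (chol_to_corr \<beta> N w) powr a)
           * ennreal (\<Prod>i\<in>corr_index \<beta> N. chol_diag \<beta> w (fst (snd i)))
       = (\<Prod>j<N. ball_weight (corr_row_index \<beta> j) (a + real \<beta> * real (N - 1 - j) / 2) w)"
proof (cases "\<forall>j<N. row_sq_norm \<beta> w j < 1")
  case True
  have "chol_diag \<beta> w k ^ ((N - Suc k) * \<beta>) = (1 - row_sq_norm \<beta> w k) powr (real \<beta> * real (N - 1 - k) / 2)"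
    if "k < N" for k
  proof -
    have "row_sq_norm \<beta> w k < 1" using True that by simp
    then have "chol_diag \<beta> w k = (1 - row_sq_norm \<beta> w k) powr (1/2)" and "1 - row_sq_norm \<beta> w k \<noteq> 0"
      by (simp_all add: chol_diag_def powr_half_sqrt)
    then have "chol_diag \<beta> w k ^ ((N - Suc k) * \<beta>)
        = (1 - row_sq_norm \<beta> w k) powr (real ((N - Suc k) * \<beta>) * (1/2))"
      by (simp add: powr_power)
    also have "real ((N - Suc k) * \<beta>) * (1/2) = real \<beta> * real (N - 1 - k) / 2" by simp
    finally show ?thesis .
  qed
  then have "(\<Prod>i\<in>corr_index \<beta> N. chol_diag \<beta> w (fst (snd i)))
      = (\<Prod>j<N. (1 - row_sq_norm \<beta> w j) powr (real \<beta> * real (N - 1 - j) / 2))"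
    by (simp add: prod_corr_index_column)
  with True show ?thesis
    using corr_integrand_chol_to_corr[OF \<beta>, of N w a]
    by (simp add: prod_ball_weight_in_ball ennreal_mult'[symmetric] prod_nonneg powr_add prod.distrib)
next
  case False
  then show ?thesis using chol_to_corr_notin_corr_set[OF \<beta> False] prod_ball_weight_outside by simp
qed

lemma nn_integral_corr_det_powr:
  fixes N \<beta> :: nat and a :: real
  assumes \<beta>: "\<beta> \<in> {1, 2, 4}" and a: "a > -1"
  shows "(\<integral>\<^sup>+x. indicator (corr_set \<beta> N) x * ennreal (corr_det \<beta> N x powr a) \<partial>corr_measure \<beta> N)
       = ennreal (\<Prod>j<N. \<Prod>i<\<beta> * j. Beta (a + real \<beta> * real (N - 1 - j) / 2 + 1 + real i / 2) (1/2))"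
proof -
  let ?g = "\<lambda>x. indicator (corr_set \<beta> N) x * ennreal (corr_det \<beta> N x powr a)"
  let ?M = "PiM (corr_index \<beta> N) (\<lambda>_. lborel :: real measure)"
  note tri = triangular_coeffs_chol[OF \<beta>, of N]
  \<comment> \<open>\<open>corr_set\<close> quantifies over all vectors; its measurability comes from the parametrization\<close>
  have "?g \<in> borel_measurable ?M"
    by (rule borel_measurable_triangular_affine_cancel[OF tri])
       (simp add: chol_to_corr_def[symmetric] corr_integrand_chol_to_corr[OF \<beta>] borel_measurable_prod_ennreal)
  then have "(\<integral>\<^sup>+x. ?g x \<partial>corr_measure \<beta> N)
      = (\<integral>\<^sup>+w. ?g (chol_to_corr \<beta> N w) * ennreal (\<Prod>i\<in>corr_index \<beta> N. chol_diag \<beta> w (fst (snd i))) \<partial>?M)"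
    unfolding corr_measure_def chol_to_corr_def by (rule nn_integral_triangular_affine[OF tri, symmetric])
  also have "\<dots> = (\<integral>\<^sup>+w. (\<Prod>j<N. ball_weight (corr_row_index \<beta> j) (a + real \<beta> * real (N - 1 - j) / 2) w) \<partial>?M)"
    by (simp only: corr_integrand_chol_to_corr_jacobian[OF \<beta>])
  also have "\<dots> = ennreal (\<Prod>j<N. \<Prod>i<\<beta> * j. Beta (a + real \<beta> * real (N - 1 - j) / 2 + 1 + real i / 2) (1/2))"
  proof (rule nn_integral_corr_rows)
    fix j
    have "real \<beta> * real (N - 1 - j) / 2 \<ge> 0" by simp
    with a show "a + real \<beta> * real (N - 1 - j) / 2 > -1" by linarith
  qed
  finally show ?thesis .
qed

theorem mainTheorem5:
  fixes N \<beta> :: nat and a :: real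
  assumes "N \<ge> 2" and "a > -1" and "\<beta> \<in> {1, 2, 4}"
  shows "(\<integral>\<^sup>+ x. indicator (corr_set \<beta> N) x * ennreal (corr_det \<beta> N x powr a)
            \<partial>corr_measure \<beta> N)
         = ennreal (\<Prod>k=1..N-1. \<Prod>s<\<beta>.
              (Beta (a + (real \<beta> * real k + 1 - real s) / 2) (1/2)) ^ k) \<and>
         (\<Prod>k=1..N-1. \<Prod>s<\<beta>. (Beta (a + (real \<beta> * real k + 1 - real s) / 2) (1/2 :: real)) ^ k)
         = (\<Prod>k=1..N-1. (pi powr (real \<beta> / 2) * Gamma (a + real \<beta> * (real k - 1) / 2 + 1)
                          / Gamma (a + real \<beta> * real k / 2 + 1)) ^ k) \<and>
         (\<Prod>k=1..N-1. (pi powr (real \<beta> / 2) * Gamma (a + real \<beta> * (real k - 1) / 2 + 1)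
                          / Gamma (a + real \<beta> * real k / 2 + 1)) ^ k)
         = pi powr (real \<beta> * real N * (real N - 1) / 4)
           / (Gamma (a + real \<beta> / 2 * (real N - 1) + 1)) ^ (N - 1)
           * (\<Prod>k=1..N-1. Gamma (a + real \<beta> / 2 * (real k - 1) + 1))"
proof -
  have N: "N \<ge> 1" using assms(1) by simp
  have rows: "(\<Prod>k=1..N-1. \<Prod>s<\<beta>. (Beta (a + (real \<beta> * real k + 1 - real s) / 2) (1/2)) ^ k)
      = (\<Prod>k=1..N-1. (pi powr (real \<beta> / 2) * Gamma (a + real \<beta> * (real k - 1) / 2 + 1)
                          / Gamma (a + real \<beta> * real k / 2 + 1)) ^ k)"
    using prod_Beta_row[OF assms(2)] by (intro prod.cong) (simp_all add: prod_power_distrib[symmetric])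
  note closed_form = prod_Gamma_ratio_powers[OF assms(2) N, of \<beta>]
  have "(\<integral>\<^sup>+ x. indicator (corr_set \<beta> N) x * ennreal (corr_det \<beta> N x powr a) \<partial>corr_measure \<beta> N)
      = ennreal (\<Prod>k=1..N-1. \<Prod>s<\<beta>. (Beta (a + (real \<beta> * real k + 1 - real s) / 2) (1/2)) ^ k)"
    unfolding nn_integral_corr_det_powr[OF assms(3,2)] prod_Beta_balls[OF assms(2) N] rows closed_form ..
  with rows closed_form show ?thesis by blast
qed

end
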